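(* For integers $n \ge 1$ and $m \ge 1$, let $Q_{n,m}$ be the number of distinct quiddities (as ordered $(n+2)$-tuples, with the vertices of the polygon labelled in cyclic order) of $3$-periodic dissections of the convex $(n+2)$-gon into $m$ cells. Then $Q_{n,m}=0$ unless $n \equiv m \pmod 3$, and if $n \equiv m \pmod 3$ then $$Q_{n,m} = \sum_{0 \le s \le (n-m)/3} \frac{n-m-3s+2}{n-s+1}\binom{m+s-2}{s}\binom{n+m-s-1}{m-1},$$ where the sum is over integers $s$ (and is empty, hence $0$, when $m>n$).
   Context: A dissection of a convex polygon is a partition of it into sub-polygons (cells) by a set of pairwise non-crossing diagonals; a dissection is determined by its set of diagonals. The quiddity of a dissection of the $N$-gon with vertices $1,\dots,N$ in cyclic order is the $N$-tuple $(c_1,\dots,c_N)$, where $c_i$ is the number of cells having vertex $i$ as one of their vertices. A dissection is $\ell$-periodic if the number of vertices of every cell is congruent to $3$ modulo $\ell$; in particular it is $3$-periodic if every cell has a number of vertices divisible by $3$. *)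

theory Defs
  imports Complex_Main
begin

text \<open>Vertices of the convex N-gon are 0, ..., N-1 in cyclic order.
  A segment between two vertices is represented as a pair (a,b) with a < b.\<close>

definition side :: "nat \<Rightarrow> nat \<Rightarrow> nat \<Rightarrow> bool" where
  "side N a b \<longleftrightarrow> a < b \<and> b < N \<and> (b = a + 1 \<or> (a = 0 \<and> b = N - 1))"

definition diagonals :: "nat \<Rightarrow> (nat \<times> nat) set" where
  "diagonals N = {(a, b). a < b \<and> b < N \<and> \<not> side N a b}"

definition crossing :: "nat \<times> nat \<Rightarrow> nat \<times> nat \<Rightarrow> bool" where
  "crossing e f \<longleftrightarrow>
     (fst e < fst f \<and> fst f < snd e \<and> snd e < snd f) \<or>
     (fst f < fst e \<and> fst e < snd f \<and> snd f < snd e)"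

definition dissection :: "nat \<Rightarrow> (nat \<times> nat) set \<Rightarrow> bool" where
  "dissection N D \<longleftrightarrow> N \<ge> 3 \<and> D \<subseteq> diagonals N \<and> (\<forall>e\<in>D. \<forall>f\<in>D. \<not> crossing e f)"

text \<open>For a < b in a vertex set C, a and b are consecutive in C (in the cyclic order)
  iff one of the two open arcs of the polygon between a and b contains no vertex of C.\<close>
definition consecutive_in :: "nat \<Rightarrow> nat set \<Rightarrow> nat \<Rightarrow> nat \<Rightarrow> bool" where
  "consecutive_in N C a b \<longleftrightarrow>
     C \<inter> {a<..<b} = {} \<or> C \<inter> ({..<a} \<union> {b<..<N}) = {}"

text \<open>Cells of a dissection (as vertex sets): convex sub-polygons whose sides are polygon sides
  or diagonals of D, and which are not subdivided by any diagonal of D.\<close>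
definition cells :: "nat \<Rightarrow> (nat \<times> nat) set \<Rightarrow> nat set set" where
  "cells N D = {C. C \<subseteq> {0..<N} \<and> card C \<ge> 3 \<and>
     (\<forall>a\<in>C. \<forall>b\<in>C. a < b \<longrightarrow>
        (consecutive_in N C a b \<longleftrightarrow> (side N a b \<or> (a, b) \<in> D)))}"

definition quiddity :: "nat \<Rightarrow> (nat \<times> nat) set \<Rightarrow> nat list" where
  "quiddity N D = map (\<lambda>i. card {C \<in> cells N D. i \<in> C}) [0..<N]"

definition periodic :: "nat \<Rightarrow> nat \<Rightarrow> (nat \<times> nat) set \<Rightarrow> bool" where
  "periodic l N D \<longleftrightarrow> (\<forall>C \<in> cells N D. card C mod l = 3 mod l)"

definition Q :: "nat \<Rightarrow> nat \<Rightarrow> nat" where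
  "Q n m = card {quiddity (n + 2) D | D. dissection (n + 2) D \<and> periodic 3 (n + 2) D
                                        \<and> card (cells (n + 2) D) = m}"

end

theory Submission
  imports Defs
begin

text \<open>
  Cutting off the cell at a base side turns a dissection into a plane forest. Walk around it and
  record a letter \<open>U\<close> for each incidence of a cell with a vertex and a letter \<open>S\<close> each time a diagonal
  is crossed, descending into a cell or returning from it. Consecutive letters \<open>UU\<close> mark the passage
  to the next vertex of the polygon, so the word and the quiddity determine each other. In a 3-periodic
  dissection these words represent the identity of the free product of cyclic groups of order 2
  (generated by \<open>S\<close>) and 3 (generated by \<open>U\<close>), and following the walk in the Cayley graph gives a
  unique normal form: the non-root cells split into blocks of three vertices, with a bare side between
  consecutive blocks. These canonical forests are counted by \<open>c(r, p, q)\<close>, where \<open>r\<close> is the number of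
  trees, \<open>p\<close> the number of non-root cells and \<open>q\<close> the number of their blocks. Deleting the root of
  the first tree gives a recursion solved by
  \<open>p c(r, p, q) = r (q - 1 choose p - 1) (2 q + r - 1 choose p - 1)\<close>,
  and summing over \<open>q\<close> gives the formula.
\<close>

section \<open>Plane forests and their words\<close>

text \<open>
  \<open>Graft k r\<close> is the forest whose first tree has the forest \<open>k\<close> below its root and whose other trees
  form \<open>r\<close>. A tree with \<open>k = Empty\<close> is a bare side of the polygon; otherwise its root is a cell with
  one more side, its base, than \<open>k\<close> has trees.
\<close>
datatype forest = Empty | Graft forest forest

fun width :: "forest \<Rightarrow> nat" where
  "width Empty = 0"
| "width (Graft k r) = Suc (width r)"

fun branching :: "(nat \<Rightarrow> bool) \<Rightarrow> forest \<Rightarrow> bool" where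
  "branching P Empty = True"
| "branching P (Graft k r) = ((k = Empty \<or> P (width k)) \<and> branching P k \<and> branching P r)"

fun nodes :: "forest \<Rightarrow> nat" where
  "nodes Empty = 0"
| "nodes (Graft k r) = of_bool (k \<noteq> Empty) + nodes k + nodes r"

fun inner :: "forest \<Rightarrow> nat" where
  "inner Empty = 0"
| "inner (Graft k r) = width k + inner k + inner r"

fun join :: "forest \<Rightarrow> forest \<Rightarrow> forest" where
  "join Empty g = g"
| "join (Graft k r) g = Graft k (join r g)"

lemma width_eq_0_iff [simp]: "width f = 0 \<longleftrightarrow> f = Empty"
  by (cases f) auto

lemma width_join [simp]: "width (join f g) = width f + width g"
  by (induction f) auto

lemma branching_join [simp]: "branching P (join f g) \<longleftrightarrow> branching P f \<and> branching P g"
  by (induction f) auto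

lemma nodes_join [simp]: "nodes (join f g) = nodes f + nodes g"
  by (induction f) auto

lemma inner_join [simp]: "inner (join f g) = inner f + inner g"
  by (induction f) auto

lemma join_inject:
  "width f = width f' \<Longrightarrow> join f g = join f' g' \<longleftrightarrow> f = f' \<and> g = g'"
proof (induction f arbitrary: f')
  case (Graft k r)
  then show ?case by (cases f') auto
qed auto

lemma join_split:
  "d \<le> width h \<Longrightarrow> \<exists>f g. h = join f g \<and> width f = d"
proof (induction h arbitrary: d)
  case (Graft k r)
  show ?case
  proof (cases d)
    case 0
    then show ?thesis by (intro exI[of _ Empty] exI[of _ "Graft k r"]) auto
  next
    case (Suc d')
    then obtain f g where "r = join f g" "width f = d'" using Graft.IH(2)[of d'] Graft.prems Suc by auto
    then show ?thesis using Suc by (intro exI[of _ "Graft k f"] exI[of _ g]) auto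
  qed
qed auto

datatype letter = U | S

text \<open>The incidence of the outermost cell with its last vertex is left out, so that placing
  forests side by side concatenates their words. For a cell below a root, \<open>[U, S]\<close>
  supplies this letter before the return through the base.\<close>

fun dword :: "forest \<Rightarrow> letter list" where
  "dword Empty = []"
| "dword (Graft k r) = U # (if k = Empty then [] else S # dword k @ [U, S]) @ dword r"

text \<open>
  Below a root, a canonical forest lists only the two non-base sides of each block; the bare sides
  separating the blocks are left implicit. The value on a forest of odd width is junk.
\<close>
fun loops :: "forest \<Rightarrow> letter list" where
  "loops Empty = []"
| "loops (Graft a Empty) = []"
| "loops (Graft a (Graft b r)) =
     U # (if a = Empty then [] else S # loops a @ [S]) @
     U # (if b = Empty then [] else S # loops b @ [S]) @ U # loops r"

definition hop :: "forest \<Rightarrow> letter list" where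
  "hop k = (if k = Empty then [] else S # loops k @ [S])"

lemma loops_Graft2 [simp]: "loops (Graft a (Graft b r)) = U # hop a @ U # hop b @ U # loops r"
  by (simp add: hop_def)

declare loops.simps(3) [simp del]

lemma hop_Empty [simp]: "hop Empty = []"
  by (simp add: hop_def)

text \<open>Only cells below a root are cut into blocks. At the top level all sides are listed, so
  the width there may have either parity.\<close>

fun cword :: "forest \<Rightarrow> letter list" where
  "cword Empty = []"
| "cword (Graft k r) = U # hop k @ cword r"

lemma cword_join [simp]: "cword (join f g) = cword f @ cword g"
  by (induction f) auto

lemma loops_join: "even (width f) \<Longrightarrow> loops (join f g) = loops f @ loops g"
  by (induction f rule: loops.induct) auto

text \<open>Parsing is deterministic: after the first or second \<open>U\<close> of a block,
  \<open>S\<close> opens a cell and \<open>U\<close> marks a bare side. Where a block could start,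
  the delimiter \<open>S\<close> ends the reading.\<close>

lemma loops_inject:
  assumes "branching even f" "even (width f)" "branching even g" "even (width g)"
    and "loops f @ S # x = loops g @ S # y"
  shows "f = g \<and> x = y"
  using assms
proof (induction f arbitrary: g x y rule: loops.induct)
  case 1
  then show ?case by (cases g rule: loops.cases) auto
next
  case (2 a)
  then show ?case by simp
next
  case (3 a b r)
  obtain a' b' r' where g: "g = Graft a' (Graft b' r')"
    using "3.prems" by (cases g rule: loops.cases) auto
  have hop_inject: "k = k' \<and> u = v" if "hop k @ U # u = hop k' @ U # v" "branching even k'"
      "k' = Empty \<or> even (width k')" "k = a \<or> k = b" for k k' u v
    using that "3.IH"(1)[of k' "U # u" "U # v"] "3.IH"(2)[of k' "U # u" "U # v"] "3.prems"
    by (auto simp: hop_def split: if_splits)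
  have eq: "hop a @ U # hop b @ U # loops r @ S # x = hop a' @ U # hop b' @ U # loops r' @ S # y"
    using "3.prems" g by simp
  have a: "a = a' \<and> hop b @ U # loops r @ S # x = hop b' @ U # loops r' @ S # y"
    by (rule hop_inject) (use eq "3.prems" g in auto)
  have b: "b = b' \<and> loops r @ S # x = loops r' @ S # y"
    by (rule hop_inject) (use a "3.prems" g in auto)
  have "r = r' \<and> x = y"
    by (rule "3.IH"(3)) (use b "3.prems" g in auto)
  with a b g show ?case by simp
qed

text \<open>Uniqueness of the normal form. With the last \<open>U\<close> restored, every
  \<open>hop\<close> is followed by \<open>U\<close>, so its first letter tells whether it is
  empty.\<close>

lemma cword_inject:
  "branching even f \<Longrightarrow> branching even g \<Longrightarrow> cword f @ [U] = cword g @ [U] \<Longrightarrow> f = g"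
proof (induction f arbitrary: g)
  case Empty
  then show ?case by (cases g) auto
next
  case (Graft k r)
  obtain k' r' where g: "g = Graft k' r'" using Graft.prems by (cases g) auto
  have start: "\<exists>z. cword h @ [U] = U # z" for h by (cases h) auto
  obtain z z' where z: "cword r @ [U] = U # z" "cword r' @ [U] = U # z'" using start by blast
  have eq: "hop k @ U # z = hop k' @ U # z'" using Graft.prems g z by simp
  have "k = k' \<and> z = z'"
  proof (cases "k = Empty \<or> k' = Empty")
    case True
    then show ?thesis using eq by (auto simp: hop_def split: if_splits)
  next
    case False
    then have "loops k @ S # U # z = loops k' @ S # U # z'" using eq by (simp add: hop_def)
    then have "k = k' \<and> U # z = U # z'"
      using False Graft.prems g by (intro loops_inject) auto
    then show ?thesis by simp
  qed
  moreover from this have "r = r'"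
    by (intro Graft.IH(2)) (use Graft.prems g z in auto)
  ultimately show ?case using g by simp
qed

text \<open>The third \<open>U\<close> of a block that is followed by another block is read as a
  bare side, now explicit. From \<open>q\<close> blocks this gives \<open>3 * q - 1\<close> trees,
  and the last \<open>U\<close> is the one that \<open>cword\<close> leaves out.\<close>

lemma loops_as_cword:
  assumes "branching even f" "even (width f)" "f \<noteq> Empty"
  shows "\<exists>h. branching even h \<and> width h mod 3 = 2 \<and> cword h @ [U] = loops f"
  using assms
proof (induction f rule: loops.induct)
  case (3 a b r)
  show ?case
  proof (cases "r = Empty")
    case True
    then show ?thesis using "3.prems" by (intro exI[of _ "Graft a (Graft b Empty)"]) auto
  next
    case False
    then obtain h where h: "branching even h" "width h mod 3 = 2" "cword h @ [U] = loops r"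
      using 3 by auto
    have "width h mod 3 = 2 \<Longrightarrow> Suc (Suc (Suc (width h))) mod 3 = 2" by presburger
    then show ?thesis using h "3.prems"
      by (intro exI[of _ "Graft a (Graft b (Graft Empty h))"]) auto
  qed
qed auto

lemma width_2_mod_3_cases:
  assumes "width L mod 3 = 2"
  obtains a b where "L = Graft a (Graft b Empty)"
  | a b c r where "L = Graft a (Graft b (Graft c r))" "width r mod 3 = 2"
proof -
  obtain a t where L: "L = Graft a t" using assms by (cases L) auto
  then obtain b u where t: "t = Graft b u" using assms by (cases t) auto
  show ?thesis
  proof (cases u)
    case Empty
    then show ?thesis using L t that(1) by blast
  next
    case (Graft c r)
    have "width r mod 3 = 2" using assms L t Graft by simp
    then show ?thesis using L t Graft that(2) by blast
  qed
qed

text \<open>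
  Scanning the sides of a cell in groups of three, a bare third side separates two blocks and the
  cell is continued. A third side carrying a cell \<open>c\<close> ends the block there: in the same word,
  \<open>c\<close> becomes part of the parent, between the block ended and a new cell. The forest \<open>acc\<close> holds the
  blocks already read.
\<close>
lemma regroup:
  assumes "branching even L" "width L mod 3 = 2" "branching even acc" "even (width acc)"
  shows "\<exists>G. branching even G \<and> width G mod 3 = 1 \<and>
    cword G = U # S # loops acc @ cword L @ [U, S]"
  using assms
proof (induction "size L" arbitrary: L acc rule: less_induct)
  case less
  from less.prems(2) show ?case
  proof (cases rule: width_2_mod_3_cases)
    case (1 a b)
    \<comment> \<open>The sides run out here: the last block joins those in \<open>acc\<close> and
      the cell is closed.\<close>
    define k where "k = join acc (Graft a (Graft b Empty))"
    have "k \<noteq> Empty" unfolding k_def by (cases acc) auto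
    then show ?thesis using 1 less.prems
      by (intro exI[of _ "Graft k Empty"]) (auto simp: k_def hop_def loops_join)
  next
    case (2 a b c r)
    define k where "k = join acc (Graft a (Graft b Empty))"
    have k: "k \<noteq> Empty" unfolding k_def by (cases acc) auto
    have ke: "branching even k" "even (width k)" unfolding k_def using 2 less.prems by simp_all
    have kl: "loops k = loops acc @ U # hop a @ U # hop b @ [U]"
      unfolding k_def by (simp add: loops_join less.prems(4))
    show ?thesis
    proof (cases "c = Empty")
      case True
      have "\<exists>G. branching even G \<and> width G mod 3 = 1 \<and>
          cword G = U # S # loops k @ cword r @ [U, S]"
        by (rule less.hyps) (use 2 ke less.prems in auto)
      then show ?thesis using 2 kl True by auto
    next
      case False
      have "\<exists>G. branching even G \<and> width G mod 3 = 1 \<and>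
          cword G = U # S # loops Empty @ cword r @ [U, S]"
        by (rule less.hyps) (use 2 less.prems in auto)
      then obtain G where G: "branching even G" "width G mod 3 = 1"
        "cword G = U # S # cword r @ [U, S]" by auto
      obtain h where h: "branching even h" "width h mod 3 = 2" "cword h @ [U] = loops c"
        using loops_as_cword[of c] False 2 less.prems by auto
      \<comment> \<open>The word of \<open>c\<close> is read at the level of the parent as the trees
        \<open>h\<close>. Its final \<open>U\<close> then serves as the first letter of
        \<open>G\<close>.\<close>
      have h': "loops c @ z = cword h @ U # z" for z
        by (simp flip: h(3))
      have "(width h + width G) mod 3 = (2 + 1) mod 3"
        by (rule mod_add_cong) (use h(2) G(2) in auto)
      then have "width (Graft k (join h G)) mod 3 = 1" by (simp add: mod_Suc)
      moreover have "branching even (Graft k (join h G))" using G(1) h(1) ke by simp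
      moreover have "cword (Graft k (join h G)) = U # S # loops acc @ cword L @ [U, S]"
        using k False by (simp add: 2(1) hop_def h' kl G(3))
      ultimately show ?thesis by blast
    qed
  qed
qed

text \<open>Working upwards, the forest below a root is made canonical first and
  \<open>regroup\<close> then splits the root cell. One tree becomes a number of trees congruent to
  1 modulo 3, so the width condition survives for the next level.\<close>

lemma canonical_of_periodic:
  assumes "branching (\<lambda>d. d mod 3 = 2) f"
  shows "\<exists>g. branching even g \<and> width g mod 3 = width f mod 3 \<and> cword g = dword f"
  using assms
proof (induction f)
  case Empty
  then show ?case by (intro exI[of _ Empty]) auto
next
  case (Graft k r)
  then obtain r' where r': "branching even r'" "width r' mod 3 = width r mod 3" "cword r' = dword r"
    by auto
  show ?case
  proof (cases "k = Empty")
    case True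
    then show ?thesis using r' by (intro exI[of _ "Graft Empty r'"]) (auto simp: mod_Suc)
  next
    case False
    then obtain k' where "branching even k'" "width k' mod 3 = 2" "cword k' = dword k"
      using Graft by auto
    with regroup[of k' Empty] obtain G where
      G: "branching even G" "width G mod 3 = 1" "cword G = U # S # dword k @ [U, S]" by auto
    have "(width G + width r') mod 3 = (1 + width r) mod 3"
      by (rule mod_add_cong) (use G(2) r'(2) in auto)
    then show ?thesis using r' G False by (intro exI[of _ "join G r'"]) auto
  qed
qed

text \<open>Making the bare sides between blocks explicit merges all blocks of a cell into one cell
  with a number of sides divisible by 3. The forest \<open>h\<close> obtained this way is not a
  subterm of \<open>k\<close>, hence the induction on word length.\<close>

lemma periodic_of_canonical:
  assumes "branching even f"
  shows "\<exists>g. branching (\<lambda>d. d mod 3 = 2) g \<and> width g = width f \<and> dword g = cword f"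
  using assms
proof (induction "length (cword f)" arbitrary: f rule: less_induct)
  case less
  show ?case
  proof (cases f)
    case Empty
    then show ?thesis by (intro exI[of _ Empty]) auto
  next
    case (Graft k r)
    then obtain r' where r': "branching (\<lambda>d. d mod 3 = 2) r'" "width r' = width r" "dword r' = cword r"
      using less.hyps[of r] less.prems by auto
    show ?thesis
    proof (cases "k = Empty")
      case True
      then show ?thesis using r' Graft by (intro exI[of _ "Graft Empty r'"]) auto
    next
      case False
      then obtain h where h: "branching even h" "width h mod 3 = 2" "cword h @ [U] = loops k"
        using loops_as_cword[of k] Graft less.prems by auto
      have hop: "hop k = S # cword h @ [U, S]"
        unfolding hop_def using False by (simp flip: h(3))
      then obtain k' where k': "branching (\<lambda>d. d mod 3 = 2) k'" "width k' = width h" "dword k' = cword h"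
        using less.hyps[of h] h Graft by auto
      moreover have "k' \<noteq> Empty" using k' h by auto
      ultimately show ?thesis using r' h hop Graft by (intro exI[of _ "Graft k' r'"]) auto
    qed
  qed
qed

section \<open>Counting canonical forests\<close>

text \<open>A block has two listed sides and three letters \<open>U\<close>; a cell below a root has
  its base crossed twice. The factor 2 on the left avoids a division.\<close>

lemma count_loops:
  assumes "branching even f" "even (width f)"
  shows "2 * count_list (loops f) U = 3 * (width f + inner f)"
    and "count_list (loops f) S = 2 * nodes f"
  using assms
  by (induction f rule: loops.induct) (auto simp: hop_def)

lemma count_cword:
  assumes "branching even f"
  shows "2 * count_list (cword f) U = 2 * width f + 3 * inner f"
    and "count_list (cword f) S = 2 * nodes f"
proof -
  have "2 * count_list (hop k) U = 3 * (width k + inner k) \<and>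
      count_list (hop k) S = 2 * (of_bool (k \<noteq> Empty) + nodes k)"
    if "branching even k" "k = Empty \<or> even (width k)" for k
    using that count_loops[of k] by (auto simp: hop_def)
  then show "2 * count_list (cword f) U = 2 * width f + 3 * inner f"
    "count_list (cword f) S = 2 * nodes f"
    using assms by (induction f) (auto simp: algebra_simps)
qed

text \<open>Each block contributes two sides to \<open>inner\<close>, so \<open>q\<close> is the
  number of blocks.\<close>

definition canonical :: "nat \<Rightarrow> nat \<Rightarrow> nat \<Rightarrow> forest set" where
  "canonical r p q = {f. branching even f \<and> width f = r \<and> nodes f = p \<and> inner f = 2 * q}"

lemma even_inner: "branching even f \<Longrightarrow> even (inner f)"
  by (induction f) auto

definition canonical_step :: "nat \<Rightarrow> nat \<Rightarrow> nat \<Rightarrow> nat \<Rightarrow> forest set" where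
  "canonical_step r p q i =
     {Graft k g |k g. k \<noteq> Empty \<and> width k = 2 * i \<and> Graft k g \<in> canonical (Suc r) p q}"

text \<open>Deleting the root cell of the first tree, which has \<open>i\<close> blocks, releases
  its \<open>2 * i\<close> trees to the top level in front of the other \<open>r\<close>.
  Conversely, the first \<open>2 * i\<close> trees are gathered under a new root.\<close>

lemma canonical_step_bij:
  assumes "1 \<le> i" "i \<le> q"
  shows "\<exists>\<phi>. bij_betw \<phi> (canonical_step r (Suc p) q i) (canonical (r + 2 * i) p (q - i))"
proof -
  define \<phi> where "\<phi> f = (case f of Graft k g \<Rightarrow> join k g | Empty \<Rightarrow> Empty)" for f
  have "bij_betw \<phi> (canonical_step r (Suc p) q i) (canonical (r + 2 * i) p (q - i))"
    unfolding bij_betw_def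
  proof (intro conjI equalityI subsetI)
    show "inj_on \<phi> (canonical_step r (Suc p) q i)"
      by (auto simp: inj_on_def canonical_step_def \<phi>_def join_inject)
  next
    fix h assume "h \<in> \<phi> ` canonical_step r (Suc p) q i"
    then show "h \<in> canonical (r + 2 * i) p (q - i)"
      by (auto simp: canonical_step_def \<phi>_def canonical_def)
  next
    fix h assume h: "h \<in> canonical (r + 2 * i) p (q - i)"
    then obtain k g where kg: "h = join k g" "width k = 2 * i"
      using join_split[of "2 * i" h] by (auto simp: canonical_def)
    have "k \<noteq> Empty" using kg(2) assms(1) by auto
    then have "Graft k g \<in> canonical_step r (Suc p) q i"
      using h kg assms by (auto simp: canonical_step_def canonical_def)
    moreover have "\<phi> (Graft k g) = h" by (simp add: \<phi>_def kg)
    ultimately show "h \<in> \<phi> ` canonical_step r (Suc p) q i" by blast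
  qed
  then show ?thesis by blast
qed

lemma canonical_Suc:
  "canonical (Suc r) p q =
     Graft Empty ` canonical r p q \<union> (\<Union>i\<in>{1..q}. canonical_step r p q i)" (is "?L = ?R")
proof (intro equalityI subsetI)
  fix f assume f: "f \<in> ?L"
  then obtain k g where kg: "f = Graft k g" by (cases f) (auto simp: canonical_def)
  show "f \<in> ?R"
  proof (cases "k = Empty")
    case True
    then show ?thesis using f kg by (auto simp: canonical_def)
  next
    case False
    then obtain i where i: "width k = 2 * i" using f kg by (auto simp: canonical_def elim: evenE)
    have "i \<noteq> 0" using i False by (auto simp flip: width_eq_0_iff)
    then have "i \<in> {1..q}" "f \<in> canonical_step r p q i"
      using i False f kg by (auto simp: canonical_def canonical_step_def)
    then show ?thesis by blast
  qed
qed (auto simp: canonical_def canonical_step_def)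

lemma canonical_step_0: "canonical_step r 0 q i = {}"
  by (auto simp: canonical_step_def canonical_def)

lemma canonical_0: "canonical 0 p q = (if p = 0 \<and> q = 0 then {Empty} else {})"
  by (auto simp: canonical_def)

lemma finite_canonical: "finite (canonical r p q)"
proof (induction p arbitrary: r q)
  case 0
  show ?case by (induction r) (auto simp: canonical_0 canonical_Suc canonical_step_0)
next
  case (Suc p)
  have "finite (canonical_step r (Suc p) q i)" if "i \<in> {1..q}" for r i
    using canonical_step_bij[of i q r p] that bij_betw_finite Suc by fastforce
  then show ?case by (induction r) (auto simp: canonical_0 canonical_Suc)
qed

lemma card_canonical_Suc:
  "card (canonical (Suc r) (Suc p) q) =
     card (canonical r (Suc p) q) + (\<Sum>i=1..q. card (canonical (r + 2 * i) p (q - i)))"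
proof -
  have fin: "finite (canonical_step r (Suc p) q i)" for i
    by (rule finite_subset[OF _ finite_canonical]) (auto simp: canonical_step_def)
  have "card (canonical (Suc r) (Suc p) q) =
      card (Graft Empty ` canonical r (Suc p) q) + card (\<Union>i\<in>{1..q}. canonical_step r (Suc p) q i)"
    unfolding canonical_Suc using fin
    by (intro card_Un_disjoint) (auto simp: finite_canonical canonical_step_def)
  also have "card (Graft Empty ` canonical r (Suc p) q) = card (canonical r (Suc p) q)"
    by (intro card_image) (auto simp: inj_on_def)
  also have "card (\<Union>i\<in>{1..q}. canonical_step r (Suc p) q i) =
      (\<Sum>i=1..q. card (canonical_step r (Suc p) q i))"
    using fin by (intro card_UN_disjoint) (auto simp: canonical_step_def)
  also have "\<dots> = (\<Sum>i=1..q. card (canonical (r + 2 * i) p (q - i)))"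
  proof (intro sum.cong refl)
    fix i assume "i \<in> {1..q}"
    then show "card (canonical_step r (Suc p) q i) = card (canonical (r + 2 * i) p (q - i))"
      using canonical_step_bij[of i q r p] by (auto dest: bij_betw_same_card)
  qed
  finally show ?thesis .
qed

lemma card_canonical_0: "card (canonical r 0 q) = of_bool (q = 0)"
proof (induction r)
  case (Suc r)
  have "card (canonical (Suc r) 0 q) = card (Graft Empty ` canonical r 0 q)"
    by (simp add: canonical_Suc canonical_step_0)
  also have "\<dots> = card (canonical r 0 q)"
    by (intro card_image) (auto simp: inj_on_def)
  finally show ?case using Suc by simp
qed (simp add: canonical_0)

lemma card_canonical_inner_0: "card (canonical r (Suc p) 0) = 0"
proof (induction r)
  case (Suc r)
  then show ?case by (subst card_canonical_Suc) simp
qed (simp add: canonical_0)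

section \<open>Binomial sums and the closed form for canonical forests\<close>

lemma sum_choose: "(\<Sum>i=1..q. (q - i) choose p) = q choose Suc p"
proof -
  have "(\<Sum>i=1..q. (q - i) choose p) = (\<Sum>j<q. j choose p)"
    by (rule sum.reindex_bij_witness[of _ "\<lambda>j. q - j" "\<lambda>i. q - i"]) auto
  also have "\<dots> = q choose Suc p" by (induction q) auto
  finally show ?thesis .
qed

text \<open>Both sides count the subsets of size \<open>p + 2\<close> of \<open>q + 1\<close>
  points: if the second smallest element is \<open>i + 1\<close>, there are \<open>i\<close> choices
  for the smallest and \<open>q - i\<close> points left for the rest.\<close>

lemma sum_index_choose: "(\<Sum>i=1..q. i * ((q - i) choose p)) = Suc q choose Suc (Suc p)"
proof (induction q)
  case (Suc q)
  have "(\<Sum>i=1..Suc q. i * ((Suc q - i) choose p)) =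
      (\<Sum>i=0..q. Suc i * ((q - i) choose p))"
    by (rule sum.reindex_bij_witness[of _ Suc "\<lambda>i. i - 1"]) auto
  also have "\<dots> = (\<Sum>i=0..q. i * ((q - i) choose p)) + (\<Sum>i=0..q. (q - i) choose p)"
    by (simp add: sum.distrib)
  also have "(\<Sum>i=0..q. i * ((q - i) choose p)) = (\<Sum>i=1..q. i * ((q - i) choose p))"
    by (simp add: sum.atLeast_Suc_atMost)
  also have "(\<Sum>i=0..q. (q - i) choose p) = (\<Sum>i=1..Suc q. (Suc q - i) choose p)"
    by (rule sum.reindex_bij_witness[of _ "\<lambda>i. i - 1" Suc]) auto
  finally show ?case by (simp only: Suc sum_choose) simp
qed simp

text \<open>
  The recursion is summable because the upper index \<open>2 (q - i) + (r + 2 i) + 1\<close> of the second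
  binomial coefficient does not depend on \<open>i\<close>.
\<close>
lemma card_canonical:
  "Suc p * card (canonical r (Suc p) (Suc q)) = r * (q choose p) * ((2 * q + r + 1) choose p)"
proof (induction p arbitrary: r q)
  case 0
  show ?case
  proof (induction r)
    case (Suc r)
    \<comment> \<open>A single non-root cell must take all \<open>Suc q\<close> blocks.\<close>
    have "(\<Sum>i=1..Suc q. card (canonical (r + 2 * i) 0 (Suc q - i))) = (\<Sum>i=1..Suc q. of_bool (i = Suc q))"
      by (intro sum.cong) (auto simp: card_canonical_0)
    also have "\<dots> = 1" by simp
    finally show ?case using Suc by (subst card_canonical_Suc) simp
  qed (simp add: canonical_0)
next
  case (Suc p)
  note IHp = Suc
  show ?case
  proof (induction r)
    case (Suc r)
    define M where "M = 2 * q + r + 1"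
    define X where "X = real (q choose Suc p)"
    define Y where "Y = real (M choose p)"
    define c where "c r = real (card (canonical r (Suc (Suc p)) (Suc q)))" for r
    have IH: "(real p + 2) * c r = real r * X * real (M choose Suc p)"
      using arg_cong[OF Suc, of real] by (simp add: c_def X_def M_def algebra_simps)
    \<comment> \<open>The term \<open>i = Suc q\<close> vanishes, since it leaves no blocks for the
      other \<open>Suc p\<close> cells.\<close>
    have "Suc p * (\<Sum>i=1..Suc q. card (canonical (r + 2 * i) (Suc p) (Suc q - i))) =
        Suc p * (\<Sum>i=1..q. card (canonical (r + 2 * i) (Suc p) (Suc (q - i))))"
      by (simp add: card_canonical_inner_0 Suc_diff_le)
    also have "\<dots> = (\<Sum>i=1..q. (r + 2 * i) * ((q - i) choose p) * (M choose p))"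
      unfolding sum_distrib_left
    proof (intro sum.cong refl)
      fix i assume "i \<in> {1..q}"
      then have "2 * (q - i) + (r + 2 * i) + 1 = M" by (auto simp: M_def)
      then show "Suc p * card (canonical (r + 2 * i) (Suc p) (Suc (q - i))) =
          (r + 2 * i) * ((q - i) choose p) * (M choose p)"
        using IHp[of "r + 2 * i" "q - i"]
        by (simp only:)
    qed
    also have "\<dots> = (r * (\<Sum>i=1..q. (q - i) choose p) + 2 * (\<Sum>i=1..q. i * ((q - i) choose p))) * (M choose p)"
      by (simp add: sum_distrib_left sum_distrib_right sum.distrib algebra_simps)
    finally have sum: "Suc p * (\<Sum>i=1..Suc q. card (canonical (r + 2 * i) (Suc p) (Suc q - i))) =
        (r * (q choose Suc p) + 2 * (Suc q choose Suc (Suc p))) * (M choose p)"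
      by (simp only: sum_choose sum_index_choose)
    define s where "s = real (\<Sum>i=1..Suc q. card (canonical (r + 2 * i) (Suc p) (Suc q - i)))"
    define Z where "Z = real (Suc q choose Suc (Suc p))"
    have s: "(real p + 1) * s = (real r * X + 2 * Z) * Y"
      using arg_cong[OF sum, of real] by (simp add: s_def X_def Y_def Z_def algebra_simps)
    have Z: "(real p + 2) * Z = (real q + 1) * X"
      using arg_cong[OF Suc_times_binomial_eq[of q "Suc p"], of real]
      by (simp add: Z_def X_def algebra_simps)
    have W: "(real p + 1) * real (M choose Suc p) = (real M - real p) * Y"
    proof (cases "p \<le> M")
      case True
      have "Suc p * (M choose Suc p) = (M - p) * (M choose p)"
        by (metis binomial_absorb_comp binomial_absorption mult.commute)
      from arg_cong[OF this, of real] True show ?thesis by (simp add: Y_def of_nat_diff algebra_simps)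
    qed (simp add: Y_def binomial_eq_0)
    have c: "c (Suc r) = c r + s"
      unfolding c_def s_def by (subst card_canonical_Suc) simp
    \<comment> \<open>The factors \<open>p + 1\<close> and \<open>p + 2\<close> clear the
      denominators, so that \<open>IH\<close>, \<open>s\<close>, \<open>Z\<close> and
      \<open>W\<close> apply.\<close>
    have "(real p + 1) * ((real p + 2) * c (Suc r)) =
        (real p + 1) * ((real p + 2) * c r) + (real p + 2) * ((real p + 1) * s)"
      by (simp add: c algebra_simps)
    also have "\<dots> = real r * X * ((real p + 1) * real (M choose Suc p))
        + ((real p + 2) * real r * X + 2 * ((real p + 2) * Z)) * Y"
      by (simp only: IH s) (simp add: algebra_simps)
    \<comment> \<open>Both sides are now multiples of \<open>X * Y\<close>. The cofactors
      \<open>r * (M + 2) + 2 * q + 2\<close> and \<open>(r + 1) * (M + 1)\<close> agree because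
      \<open>M = 2 * q + r + 1\<close>.\<close>
    also have "\<dots> = (real r + 1) * X * ((real p + 1) * Y + (real p + 1) * real (M choose Suc p))"
      unfolding Z W by (simp add: M_def algebra_simps)
    also have "\<dots> = (real p + 1) * ((real r + 1) * X * (Y + real (M choose Suc p)))"
      by (simp add: algebra_simps)
    finally have "(real p + 2) * c (Suc r) = (real r + 1) * X * (Y + real (M choose Suc p))"
      by simp
    also have "Y + real (M choose Suc p) = real (Suc M choose Suc p)" by (simp add: Y_def)
    finally have "real (Suc (Suc p) * card (canonical (Suc r) (Suc (Suc p)) (Suc q))) =
        real (Suc r * (q choose Suc p) * ((2 * q + Suc r + 1) choose Suc p))"
      by (simp add: c_def X_def M_def algebra_simps)
    then show ?case unfolding of_nat_eq_iff .
  qed (simp add: canonical_0)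
qed

text \<open>The root cell is not a node, whence \<open>Suc\<close>. The number of letters
  \<open>U\<close> is \<open>extent + 2 * nodes\<close> by \<open>count_dword\<close>, that is
  \<open>(n + 1) + 2 * (m - 1)\<close> for the corresponding dissection.\<close>

definition canonical_roots :: "nat \<Rightarrow> nat \<Rightarrow> forest set" where
  "canonical_roots n m = {f. branching even f \<and> width f mod 3 = 2 \<and>
     Suc (nodes f) = m \<and> count_list (cword f) U = n + 2 * m - 1}"

text \<open>Counting \<open>U\<close> gives width plus \<open>3 * q\<close>, so \<open>q\<close>
  determines the width. A width congruent to 2 modulo 3 then forces \<open>n\<close> and
  \<open>m\<close> to be congruent and bounds \<open>q\<close>.\<close>

lemma canonical_roots_eq:
  assumes "m \<ge> 1"
  shows "canonical_roots n m = (if n mod 3 = m mod 3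
    then (\<Union>q\<in>{q. 3 * q + 3 \<le> n + 2 * m}. canonical (n + 2 * m - 1 - 3 * q) (m - 1) q) else {})"
    (is "_ = ?R")
proof (intro equalityI subsetI)
  fix f assume f: "f \<in> canonical_roots n m"
  then obtain q where q: "inner f = 2 * q"
    using even_inner[of f] by (auto simp: canonical_roots_def elim: evenE)
  then have w: "width f + 3 * q + 1 = n + 2 * m"
    using f count_cword(1)[of f] assms by (auto simp: canonical_roots_def)
  have w2: "width f mod 3 = 2" using f by (simp add: canonical_roots_def)
  have "n mod 3 = m mod 3" using w w2 by presburger
  moreover have "3 * q + 3 \<le> n + 2 * m" using w w2 by presburger
  moreover have "f \<in> canonical (n + 2 * m - 1 - 3 * q) (m - 1) q"
    using f q w by (auto simp: canonical_roots_def canonical_def)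
  ultimately show "f \<in> ?R" by auto
next
  fix f assume f: "f \<in> ?R"
  then obtain q where q: "n mod 3 = m mod 3" "3 * q + 3 \<le> n + 2 * m"
    "f \<in> canonical (n + 2 * m - 1 - 3 * q) (m - 1) q" by (auto split: if_splits)
  have "3 dvd n + 2 * m" using q(1) by presburger
  then obtain K where K: "n + 2 * m = 3 * K" by (elim dvdE)
  with q(2) have "n + 2 * m - 1 - 3 * q = 2 + 3 * (K - q - 1)" by simp
  then have "(n + 2 * m - 1 - 3 * q) mod 3 = 2" by (simp only: mod_mult_self2) simp
  then show "f \<in> canonical_roots n m"
    using q count_cword(1)[of f] assms by (auto simp: canonical_roots_def canonical_def)
qed

lemma card_canonical_roots:
  assumes "m \<ge> 1" "n mod 3 = m mod 3"
  shows "card (canonical_roots n m) =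
    (\<Sum>q | 3 * q + 3 \<le> n + 2 * m. card (canonical (n + 2 * m - 1 - 3 * q) (m - 1) q))"
proof -
  have fin: "finite {q. 3 * q + 3 \<le> n + 2 * m}"
    by (rule finite_subset[of _ "{..n + 2 * m}"]) auto
  show ?thesis
    unfolding canonical_roots_eq[OF assms(1)] if_P[OF assms(2)] using fin
    by (intro card_UN_disjoint) (auto simp: finite_canonical, auto simp: canonical_def)
qed

lemma card_canonical_roots_formula:
  assumes "n \<ge> 1" "m \<ge> 1" "n mod 3 = m mod 3"
  shows "real (card (canonical_roots n m)) =
              (\<Sum>s | 3 * s + m \<le> n.
                 (real n - real m - 3 * real s + 2) / (real n - real s + 1)
                 * real ((m + s - 2) choose s) * real ((n + m - s - 1) choose (m - 1)))"
    (is "_ = sum ?g _")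
\<comment> \<open>Without non-root cells the closed form does not apply. By truncated subtraction,
  \<open>(m + s - 2) choose s\<close> is 1 for \<open>s = 0\<close> and 0 otherwise, which matches
  the single canonical forest.\<close>
proof (cases "m = 1")
  case True
  have fin: "finite {q. 3 * q + 3 \<le> n + 2 * m}"
    by (rule finite_subset[of _ "{..n + 2 * m}"]) auto
  have "card (canonical_roots n m) = (\<Sum>q | 3 * q + 3 \<le> n + 2 * m. of_bool (q = 0))"
    unfolding card_canonical_roots[OF assms(2,3)] using True by (simp add: card_canonical_0)
  also have "\<dots> = 1" using fin assms True by (simp add: of_bool_def sum.delta)
  finally have "card (canonical_roots n m) = 1" .
  moreover have "sum ?g {s. 3 * s + m \<le> n} = (\<Sum>s | 3 * s + m \<le> n. if s = 0 then 1 else 0)"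
    using True by (intro sum.cong) (auto simp: binomial_eq_0 field_simps)
  moreover have "finite {s. 3 * s + m \<le> n}" by (rule finite_subset[of _ "{..n}"]) auto
  ultimately show ?thesis using assms True by (simp add: sum.delta)
next
  case False
  with assms(2) have "m = Suc (Suc (m - 2))" by simp
  then obtain p where m: "m = Suc (Suc p)" by blast
  \<comment> \<open>Here \<open>s\<close> is the number of blocks beyond one for each of the
    \<open>m - 1\<close> non-root cells.\<close>
  have summand: "real (card (canonical (n + 2 * m - 1 - 3 * (m - 1 + s)) (m - 1) (m - 1 + s))) = ?g s"
    if s: "3 * s + m \<le> n" for s
  proof -
    define r where "r = n + 2 * m - 1 - 3 * (m - 1 + s)"
    define T where "T = n + m - s - 1"
    have r: "real r = real n - real m - 3 * real s + 2"
      using s unfolding r_def m by (simp add: of_nat_diff)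
    have T: "2 * (p + s) + r + 1 = T" using s unfolding r_def T_def m by simp
    \<comment> \<open>Absorption trades the denominator \<open>p + 1\<close> for
      \<open>n - s + 1\<close> and raises the lower index from \<open>m - 2\<close> to
      \<open>m - 1\<close>.\<close>
    have "Suc p * (T choose Suc p) = (T - p) * (T choose p)"
      by (metis binomial_absorb_comp binomial_absorption mult.commute)
    moreover have "T - p = n - s + 1" using s unfolding T_def m by simp
    ultimately have "real (Suc p * (T choose Suc p)) = real ((n - s + 1) * (T choose p))" by simp
    moreover have "real (n - s + 1) = real n - real s + 1" using s by (simp add: of_nat_diff)
    ultimately have abs: "(real p + 1) * real (T choose Suc p) = (real n - real s + 1) * real (T choose p)"
      by (simp only: of_nat_mult) (simp add: algebra_simps)
    have pos: "real n - real s + 1 > 0" using s by simp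
    have "Suc p * card (canonical r (Suc p) (Suc (p + s))) = r * ((p + s) choose p) * (T choose p)"
      using card_canonical[of p r "p + s"] T by simp
    from arg_cong[OF this, of real]
    have "(real p + 1) * real (card (canonical r (Suc p) (Suc (p + s)))) =
        real r * real ((p + s) choose s) * real (T choose p)"
      by (simp add: algebra_simps binomial_symmetric[of p "p + s"])
    also have "real (T choose p) = (real p + 1) * real (T choose Suc p) / (real n - real s + 1)"
      using abs pos by (simp add: field_simps)
    finally have "(real p + 1) * real (card (canonical r (Suc p) (Suc (p + s)))) = (real p + 1) *
        (real r / (real n - real s + 1) * real ((p + s) choose s) * real (T choose Suc p))"
      by simp
    then have "real (card (canonical r (Suc p) (Suc (p + s)))) =
        real r / (real n - real s + 1) * real ((p + s) choose s) * real (T choose Suc p)"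
      by (subst (asm) mult_cancel_left) linarith
    then show ?thesis unfolding r T_def r_def[symmetric] by (simp add: m r flip: T_def)
  qed
  \<comment> \<open>Every non-root cell has at least one block.\<close>
  have zero: "card (canonical r (m - 1) q) = 0" if "q < m - 1" for r q
  proof (cases q)
    case 0
    then show ?thesis by (simp add: m card_canonical_inner_0)
  next
    case (Suc q')
    then show ?thesis using card_canonical[of p r q'] that by (simp add: m binomial_eq_0)
  qed
  have fin: "finite {q. 3 * q + 3 \<le> n + 2 * m}"
    by (rule finite_subset[of _ "{..n + 2 * m}"]) auto
  have "card (canonical_roots n m) =
    (\<Sum>q | 3 * q + 3 \<le> n + 2 * m \<and> m - 1 \<le> q. card (canonical (n + 2 * m - 1 - 3 * q) (m - 1) q))"
    unfolding card_canonical_roots[OF assms(2,3)]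
    using fin zero by (intro sum.mono_neutral_right) (auto intro: leI)
  also have "\<dots> = (\<Sum>s | 3 * s + m \<le> n.
      card (canonical (n + 2 * m - 1 - 3 * (m - 1 + s)) (m - 1) (m - 1 + s)))"
    by (rule sum.reindex_bij_witness[of _ "\<lambda>s. m - 1 + s" "\<lambda>q. q - (m - 1)"]) (auto simp: m)
  finally show ?thesis using summand by simp
qed

section \<open>Dissections as plane forests\<close>

text \<open>
  A forest placed at vertex \<open>a\<close> occupies the vertices \<open>a, \<dots>, a + extent f\<close>. Since \<open>extent k = 0\<close>
  only for \<open>k = Empty\<close>, the maximum with 1 accounts for bare sides.
\<close>
fun extent :: "forest \<Rightarrow> nat" where
  "extent Empty = 0"
| "extent (Graft k r) = max 1 (extent k) + extent r"

fun edges :: "nat \<Rightarrow> forest \<Rightarrow> (nat \<times> nat) set" where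
  "edges a Empty = {}"
| "edges a (Graft k r) =
     insert (a, a + max 1 (extent k)) (edges a k \<union> edges (a + max 1 (extent k)) r)"

fun corners :: "nat \<Rightarrow> forest \<Rightarrow> nat set" where
  "corners a Empty = {a}"
| "corners a (Graft k r) = insert a (corners (a + max 1 (extent k)) r)"

text \<open>The cell resting on the base \<open>(a, a + extent f)\<close> of the whole forest is not
  included; an enclosing \<open>Graft\<close> adds it.\<close>

fun faces :: "nat \<Rightarrow> forest \<Rightarrow> nat set set" where
  "faces a Empty = {}"
| "faces a (Graft k r) =
     (if k = Empty then {} else {corners a k}) \<union> faces a k \<union> faces (a + max 1 (extent k)) r"

section \<open>Position of edges and corners\<close>

lemma extent_pos: "f \<noteq> Empty \<Longrightarrow> 1 \<le> extent f"
  by (cases f) auto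

lemma max_extent: "max (Suc 0) (extent k) = (if k = Empty then 1 else extent k)"
  using extent_pos[of k] by (auto simp: max_def)

lemma edges_bounds: "(x, y) \<in> edges a f \<Longrightarrow> a \<le> x \<and> x < y \<and> y \<le> a + extent f"
proof (induction f arbitrary: a)
  case (Graft k r)
  show ?case
    using Graft.prems Graft.IH(1)[of a] Graft.IH(2)[of "a + max 1 (extent k)"] by auto
qed auto

lemma corners_bounds: "v \<in> corners a f \<Longrightarrow> a \<le> v \<and> v \<le> a + extent f"
proof (induction f arbitrary: a)
  case (Graft k r)
  show ?case
    using Graft.prems Graft.IH(2)[of "a + max 1 (extent k)"] by auto
qed auto

lemma first_corner [simp]: "a \<in> corners a f"
  by (cases f) auto

lemma last_corner [simp]: "a + extent f \<in> corners a f"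
proof (induction f arbitrary: a)
  case (Graft k r)
  show ?case using Graft.IH(2)[of "a + max 1 (extent k)"] by (simp add: add.assoc)
qed auto

lemma finite_corners [simp]: "finite (corners a f)"
  by (induction f arbitrary: a) auto

lemma card_corners: "card (corners a f) = Suc (width f)"
proof (induction f arbitrary: a)
  case (Graft k r)
  have "a \<notin> corners (a + max 1 (extent k)) r" using corners_bounds by fastforce
  then show ?case using Graft.IH(2) by simp
qed auto

text \<open>Every edge stays within the span of one tree, and corners are ends of such
  spans.\<close>

lemma edges_avoid_corners:
  "(x, z) \<in> edges a f \<Longrightarrow> v \<in> corners a f \<Longrightarrow> \<not> (x < v \<and> v < z)"
proof (induction f arbitrary: a)
  case (Graft k r)
  define b where "b = a + max 1 (extent k)"
  have k: "a \<le> x \<and> z \<le> b" if "(x, z) \<in> edges a k" using edges_bounds[OF that] by (auto simp: b_def)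
  have r: "b \<le> x" if "(x, z) \<in> edges b r" using edges_bounds[OF that] by auto
  have v: "v = a \<or> v \<in> corners b r \<and> b \<le> v"
    using Graft.prems(2) corners_bounds[of v b r] by (auto simp: b_def)
  have "a < b" by (simp add: b_def)
  moreover have "(x, z) = (a, b) \<or> (x, z) \<in> edges a k \<or> (x, z) \<in> edges b r"
    using Graft.prems(1) by (auto simp: b_def)
  ultimately show ?case using k r v Graft.IH(2)[of b] by auto
qed auto

lemma corner_gap_edge:
  "x \<in> corners a f \<Longrightarrow> z \<in> corners a f \<Longrightarrow> x < z \<Longrightarrow> corners a f \<inter> {x<..<z} = {} \<Longrightarrow>
    (x, z) \<in> edges a f"
proof (induction f arbitrary: a)
  case (Graft k r)
  define b where "b = a + max 1 (extent k)"
  have ab: "a < b" by (simp add: b_def)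
  have c: "corners a (Graft k r) = insert a (corners b r)" by (simp add: b_def)
  have ge: "b \<le> v" if "v \<in> corners b r" for v using corners_bounds[OF that] by simp
  have e: "edges a (Graft k r) = insert (a, b) (edges a k \<union> edges b r)" by (simp add: b_def)
  note prems = Graft.prems[unfolded c]
  show ?case
  proof (cases "x = a")
    case True
    then have z: "z \<in> corners b r" using prems by auto
    have "b \<notin> {x<..<z}" using prems(4) first_corner[of b r] by blast
    then have "z = b" using ge[OF z] ab True by auto
    then show ?thesis using True e by simp
  next
    case False
    then have x: "x \<in> corners b r" using prems by auto
    then have z: "z \<in> corners b r" using prems ge[OF x] ab by auto
    have "(x, z) \<in> edges b r" using Graft.IH(2)[OF x z prems(3)] prems(4) by auto
    then show ?thesis using e by simp
  qed
qed auto

text \<open>With at least two trees, some corner lies strictly inside the base, and no edge passes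
  over a corner.\<close>

lemma base_not_edge: "width f \<noteq> 1 \<Longrightarrow> (a, a + extent f) \<notin> edges a f"
proof (cases f)
  case (Graft k r)
  assume "width f \<noteq> 1"
  then have "r \<noteq> Empty" using Graft by auto
  then have "1 \<le> extent r" by (rule extent_pos)
  then have "a < a + max 1 (extent k)" "a + max 1 (extent k) < a + extent f" using Graft by auto
  moreover have "a + max 1 (extent k) \<in> corners a f" using Graft by simp
  ultimately show ?thesis using edges_avoid_corners by blast
qed auto

lemma edges_noncrossing: "e \<in> edges a f \<Longrightarrow> e' \<in> edges a f \<Longrightarrow> \<not> crossing e e'"
proof (induction f arbitrary: a)
  case (Graft k r)
  define b where "b = a + max 1 (extent k)"
  have b: "edges a (Graft k r) = insert (a, b) (edges a k \<union> edges b r)" by (simp add: b_def)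
  note prems = Graft.prems[unfolded b]
  have k: "a \<le> fst e \<and> fst e < snd e \<and> snd e \<le> b" if "e \<in> edges a k" for e
    using edges_bounds[of "fst e" "snd e" a k] that by (auto simp: b_def)
  have r: "b \<le> fst e \<and> fst e < snd e" if "e \<in> edges b r" for e
    using edges_bounds[of "fst e" "snd e" b r] that by auto
  consider "e = (a, b)" | "e \<in> edges a k" | "e \<in> edges b r" using prems(1) by auto
  then show ?case
  proof cases
    case 1
    then show ?thesis using prems(2) k[of e'] r[of e'] by (auto simp: crossing_def)
  next
    case 2
    then show ?thesis using prems(2) k[of e] k[of e'] r[of e'] Graft.IH(1)[of a]
      by (auto simp: crossing_def)
  next
    case 3
    then show ?thesis using prems(2) r[of e] k[of e'] r[of e'] Graft.IH(2)[of b]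
      by (auto simp: crossing_def)
  qed
qed auto

lemma unit_edges: "a \<le> i \<Longrightarrow> i < a + extent f \<Longrightarrow> (i, Suc i) \<in> edges a f"
proof (induction f arbitrary: a)
  case (Graft k r)
  define b where "b = a + max 1 (extent k)"
  have b: "edges a (Graft k r) = insert (a, b) (edges a k \<union> edges b r)" by (simp add: b_def)
  have s: "a + extent (Graft k r) = b + extent r" by (simp add: b_def)
  show ?case
  proof (cases "i < b")
    case True
    then show ?thesis using Graft.IH(1)[of a] Graft.prems b
      by (cases "k = Empty") (auto simp: b_def max_extent)
  next
    case False
    then show ?thesis using Graft.IH(2)[of b] Graft.prems b s by auto
  qed
qed auto

section \<open>Cells as regions of an edge set\<close>

definition adjacent :: "nat set \<Rightarrow> nat \<Rightarrow> nat \<Rightarrow> bool" where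
  "adjacent C x y \<longleftrightarrow> C \<inter> {x<..<y} = {} \<or> C \<subseteq> {x..y}"

text \<open>A form of \<open>cells\<close> that does not mention the size of the polygon and treats
  sides and diagonals alike, so that it can be applied to subforests.\<close>

definition regions :: "(nat \<times> nat) set \<Rightarrow> nat set set" where
  "regions E = {C. finite C \<and> 3 \<le> card C \<and>
     (\<forall>x\<in>C. \<forall>y\<in>C. x < y \<longrightarrow> (adjacent C x y \<longleftrightarrow> (x, y) \<in> E))}"

lemma regions_cong:
  assumes "\<And>x y. x \<in> C \<Longrightarrow> y \<in> C \<Longrightarrow> x < y \<Longrightarrow> (x, y) \<in> E \<longleftrightarrow> (x, y) \<in> E'"
  shows "C \<in> regions E \<longleftrightarrow> C \<in> regions E'"
  using assms unfolding regions_def by blast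

text \<open>The least and the greatest vertex are adjacent around the outside. This confines a
  region to the span of one edge.\<close>

lemma region_extremes:
  assumes "C \<in> regions E"
  obtains x y where "x \<in> C" "y \<in> C" "(x, y) \<in> E" "C \<subseteq> {x..y}"
proof -
  have C: "finite C" "3 \<le> card C" using assms by (auto simp: regions_def)
  then have ne: "C \<noteq> {}" by auto
  have m: "Min C \<in> C" "Max C \<in> C" "C \<subseteq> {Min C..Max C}" using C(1) ne by auto
  have "Min C < Max C"
  proof (rule ccontr)
    assume "\<not> Min C < Max C"
    then have "C \<subseteq> {Min C}" using m(3) by force
    from card_mono[OF _ this] C(2) show False by simp
  qed
  moreover have "adjacent C (Min C) (Max C)" using m(3) by (simp add: adjacent_def)
  ultimately have "(Min C, Max C) \<in> E" using assms m by (auto simp: regions_def)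
  then show ?thesis using that m by blast
qed

lemma corners_region:
  assumes "k \<noteq> Empty" "width k \<noteq> 1"
  shows "corners a k \<in> regions (insert (a, a + extent k) (edges a k))"
proof -
  have "3 \<le> card (corners a k)" using assms by (cases "width k") (auto simp: card_corners)
  moreover have "adjacent (corners a k) x y \<longleftrightarrow> (x, y) \<in> insert (a, a + extent k) (edges a k)"
    if xy: "x \<in> corners a k" "y \<in> corners a k" "x < y" for x y
  proof
    assume "adjacent (corners a k) x y"
    then show "(x, y) \<in> insert (a, a + extent k) (edges a k)"
      unfolding adjacent_def
    proof
      assume "corners a k \<inter> {x<..<y} = {}"
      then show ?thesis using corner_gap_edge[OF xy] by simp
    next
      assume "corners a k \<subseteq> {x..y}"
      then have "a \<in> {x..y}" "a + extent k \<in> {x..y}" by (meson first_corner last_corner subsetD)+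
      then have "x = a \<and> y = a + extent k" using corners_bounds[OF xy(1)] corners_bounds[OF xy(2)] by auto
      then show ?thesis by simp
    qed
  next
    assume "(x, y) \<in> insert (a, a + extent k) (edges a k)"
    then show "adjacent (corners a k) x y"
    proof
      assume "(x, y) = (a, a + extent k)"
      then show ?thesis using corners_bounds[of _ a k] by (auto simp: adjacent_def)
    next
      assume "(x, y) \<in> edges a k"
      then show ?thesis using edges_avoid_corners[of x y a k] by (auto simp: adjacent_def)
    qed
  qed
  ultimately show ?thesis by (auto simp: regions_def)
qed

text \<open>A corner missing from \<open>C\<close> would lie under an edge closing a gap of
  \<open>C\<close>, against \<open>edges_avoid_corners\<close>. A vertex of \<open>C\<close> that is
  not a corner would lie under an edge joining neighbouring corners, which then could not be a side
  of \<open>C\<close>.\<close>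

lemma region_on_base_unique:
  assumes k: "k \<noteq> Empty" "width k \<noteq> 1"
    and C: "C \<in> regions (insert (a, a + extent k) (edges a k))"
    and base: "a \<in> C" "a + extent k \<in> C" "C \<subseteq> {a..a + extent k}"
  shows "C = corners a k"
proof -
  define b where "b = a + extent k"
  have fin: "finite C" and c3: "3 \<le> card C"
    and adj: "\<And>x y. x \<in> C \<Longrightarrow> y \<in> C \<Longrightarrow> x < y \<Longrightarrow>
      adjacent C x y \<longleftrightarrow> (x, y) = (a, b) \<or> (x, y) \<in> edges a k"
    using C by (auto simp: regions_def b_def)
  have nb: "(a, b) \<notin> edges a k" unfolding b_def using base_not_edge[OF k(2)] .
  have inC: "v \<in> C" if v: "v \<in> corners a k" for v
  proof (rule ccontr)
    assume nv: "v \<notin> C"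
    have "a \<le> v" "v \<le> b" using corners_bounds[OF v] by (auto simp: b_def)
    then have vab: "a < v" "v < b" using nv base(1,2) by (metis b_def le_neq_implies_less)+
    define x where "x = Max {u \<in> C. u < v}"
    define y where "y = Min {u \<in> C. v < u}"
    have x: "x \<in> {u \<in> C. u < v}" unfolding x_def using fin base(1) vab by (intro Max_in) auto
    have y: "y \<in> {u \<in> C. v < u}" unfolding y_def using fin base(2) vab by (intro Min_in) (auto simp: b_def)
    have xmax: "u \<le> x" if "u \<in> C" "u < v" for u
      unfolding x_def by (rule Max_ge) (use fin that in auto)
    have ymin: "y \<le> u" if "u \<in> C" "v < u" for u
      unfolding y_def by (rule Min_le) (use fin that in auto)
    have gap: "C \<inter> {x<..<y} = {}"
    proof (rule equals0I)
      fix u assume u: "u \<in> C \<inter> {x<..<y}"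
      then have "u \<noteq> v" using nv by auto
      then show False using u xmax[of u] ymin[of u] by (cases "u < v") auto
    qed
    then have "adjacent C x y" by (simp add: adjacent_def)
    then have "(x, y) = (a, b) \<or> (x, y) \<in> edges a k" using adj x y by auto
    \<comment> \<open>A gap spanning the whole base would leave \<open>C\<close> only two
      vertices.\<close>
    moreover have "(x, y) \<noteq> (a, b)"
    proof
      assume "(x, y) = (a, b)"
      then have "C \<subseteq> {a, b}" using gap base(3) by (force simp: b_def)
      then have "card C \<le> card {a, b}" by (intro card_mono) auto
      also have "\<dots> \<le> 2" by (simp add: card_insert_if)
      finally show False using c3 by simp
    qed
    ultimately show False using edges_avoid_corners[of x y a k v] v x y by auto
  qed
  have "v \<in> corners a k" if v: "v \<in> C" for v
  proof (rule ccontr)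
    assume nv: "v \<notin> corners a k"
    have "a \<le> v" "v \<le> b" using v base(3) by (auto simp: b_def)
    then have vab: "a < v" "v < b" using nv by (metis b_def le_neq_implies_less first_corner last_corner)+
    define x where "x = Max {u \<in> corners a k. u < v}"
    define y where "y = Min {u \<in> corners a k. v < u}"
    have x: "x \<in> {u \<in> corners a k. u < v}" unfolding x_def
      by (rule Max_in) (use vab first_corner[of a k] in \<open>auto simp del: first_corner\<close>)
    have y: "y \<in> {u \<in> corners a k. v < u}" unfolding y_def
      by (rule Min_in) (use vab last_corner[of a k] in \<open>auto simp: b_def simp del: last_corner\<close>)
    have xmax: "u \<le> x" if "u \<in> corners a k" "u < v" for u
      unfolding x_def by (rule Max_ge) (use that in auto)
    have ymin: "y \<le> u" if "u \<in> corners a k" "v < u" for u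
      unfolding y_def by (rule Min_le) (use that in auto)
    have gap: "corners a k \<inter> {x<..<y} = {}"
    proof (rule equals0I)
      fix u assume u: "u \<in> corners a k \<inter> {x<..<y}"
      then have "u \<noteq> v" using nv by auto
      then show False using u xmax[of u] ymin[of u] by (cases "u < v") auto
    qed
    have e: "(x, y) \<in> edges a k" by (rule corner_gap_edge) (use x y gap in auto)
    \<comment> \<open>As \<open>v\<close> lies in the gap, only the outer alternative of
      \<open>adjacent\<close> remains, and it forces \<open>(x, y)\<close> to be the base.\<close>
    then have "adjacent C x y" using adj[of x y] inC x y by auto
    moreover have "v \<in> C \<inter> {x<..<y}" using v x y by auto
    ultimately have "C \<subseteq> {x..y}" by (auto simp: adjacent_def)
    then have "x \<le> a" "b \<le> y" using base by (auto simp: b_def)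
    then have "(x, y) = (a, b)" using edges_bounds[OF e] by (auto simp: b_def)
    then show False using nb e by simp
  qed
  then show ?thesis using inC by blast
qed

text \<open>By its extreme edge, a region lies in the remaining trees, rests on the base of the
  first tree, or lies below it without containing both ends of that base. The condition
  \<open>d \<noteq> 1\<close> prevents a tree from repeating the base of its parent.\<close>

lemma regions_edges:
  "branching (\<lambda>d. d \<noteq> 1) f \<Longrightarrow> regions (edges a f) = faces a f"
proof (induction f arbitrary: a)
  case Empty
  have "C \<notin> regions {}" for C using region_extremes[of C "{}"] by blast
  then show ?case by auto
next
  case (Graft k r)
  define b where "b = a + max 1 (extent k)"
  define E where "E = edges a (Graft k r)"
  have E: "E = insert (a, b) (edges a k \<union> edges b r)" by (simp add: E_def b_def)
  have ab: "a < b" by (simp add: b_def)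
  have k: "a \<le> x \<and> x < y \<and> y \<le> b" if "(x, y) \<in> edges a k" for x y
    using edges_bounds[OF that] by (auto simp: b_def)
  have r: "b \<le> x \<and> x < y" if "(x, y) \<in> edges b r" for x y
    using edges_bounds[OF that] by auto
  have bk: "b = a + extent k" if "k \<noteq> Empty" using that by (simp add: b_def max_extent)
  have nb: "(a, b) \<notin> edges a k"
    using base_not_edge[of k a] bk Graft.prems by (cases "k = Empty") auto
  \<comment> \<open>In each of the three positions, only the named part of \<open>E\<close> can join
    two vertices of \<open>C\<close>.\<close>
  have right: "C \<in> regions E \<longleftrightarrow> C \<in> regions (edges b r)" if "C \<subseteq> {b..}" for C
    by (rule regions_cong) (use that ab k in \<open>fastforce simp: E\<close>)
  have left: "C \<in> regions E \<longleftrightarrow> C \<in> regions (insert (a, b) (edges a k))" if "C \<subseteq> {a..b}" for C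
    by (rule regions_cong) (use that r in \<open>fastforce simp: E\<close>)
  have inside: "C \<in> regions E \<longleftrightarrow> C \<in> regions (edges a k)" if "C \<subseteq> {a..b}" "\<not> (a \<in> C \<and> b \<in> C)" for C
    by (rule regions_cong) (use that r in \<open>fastforce simp: E\<close>)
  have IHk: "regions (edges a k) = faces a k" and IHr: "regions (edges b r) = faces b r"
    using Graft by auto
  have "C \<in> faces a (Graft k r)" if C: "C \<in> regions E" for C
  proof -
    obtain x y where xy: "x \<in> C" "y \<in> C" "(x, y) \<in> E" "C \<subseteq> {x..y}" using region_extremes[OF C] .
    consider "(x, y) \<in> edges b r" | "(x, y) = (a, b)" | "(x, y) \<in> edges a k" using xy(3) E by auto
    then show ?thesis
    proof cases
      case 1
      then have "C \<subseteq> {b..}" using r xy(4) by fastforce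
      then have "C \<in> faces b r" using right C IHr by blast
      then show ?thesis by (simp add: b_def)
    next
      case 2
      have "k \<noteq> Empty"
      proof
        assume "k = Empty"
        then have "C \<subseteq> {a, a + 1}" using 2 xy(4) by (auto simp: b_def)
        then have "card C \<le> card {a, a + 1}" by (intro card_mono) auto
        then show False using C by (auto simp: regions_def)
      qed
      moreover from this have "C = corners a k"
        using region_on_base_unique[of k C a] left[of C] C xy 2 bk Graft.prems by auto
      ultimately show ?thesis by simp
    next
      case 3
      have "C \<subseteq> {a..b}" using k[OF 3] xy(4) by fastforce
      moreover have "\<not> (a \<in> C \<and> b \<in> C)"
      proof
        assume "a \<in> C \<and> b \<in> C"
        then have "x = a" "y = b" using xy(4) k[OF 3] by fastforce+
        then show False using nb 3 by simp
      qed
      ultimately have "C \<in> faces a k" using inside C IHk by blast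
      then show ?thesis by simp
    qed
  qed
  moreover have "C \<in> regions E" if C: "C \<in> faces a (Graft k r)" for C
  proof -
    consider "k \<noteq> Empty" "C = corners a k" | "C \<in> faces a k" | "C \<in> faces b r"
      using C by (auto simp: b_def split: if_splits)
    then show ?thesis
    proof cases
      case 1
      have "C \<subseteq> {a..b}" using 1 corners_bounds[of _ a k] bk by auto
      then show ?thesis using left corners_region[of k a] 1 bk Graft.prems by auto
    next
      case 2
      then have C: "C \<in> regions (edges a k)" using IHk by simp
      obtain x y where xy: "x \<in> C" "y \<in> C" "(x, y) \<in> edges a k" "C \<subseteq> {x..y}"
        using region_extremes[OF C] .
      have "C \<subseteq> {a..b}" using k[OF xy(3)] xy(4) by fastforce
      moreover have "\<not> (a \<in> C \<and> b \<in> C)"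
      proof
        assume "a \<in> C \<and> b \<in> C"
        then have "x = a" "y = b" using xy(4) k[OF xy(3)] by fastforce+
        then show False using nb xy(3) by simp
      qed
      ultimately show ?thesis using inside C by blast
    next
      case 3
      then have C: "C \<in> regions (edges b r)" using IHr by simp
      obtain x y where xy: "(x, y) \<in> edges b r" "C \<subseteq> {x..y}"
        using region_extremes[OF C] .
      then have "C \<subseteq> {b..}" using r by fastforce
      then show ?thesis using right C by blast
    qed
  qed
  ultimately show ?case unfolding E_def by blast
qed

lemma face_bounds:
  assumes "branching (\<lambda>d. d \<noteq> 1) f" "C \<in> faces a f"
  shows "C \<subseteq> {a..a + extent f}" "3 \<le> card C" "finite C"
    "width f \<noteq> 1 \<Longrightarrow> \<not> (a \<in> C \<and> a + extent f \<in> C)"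
proof -
  have C: "C \<in> regions (edges a f)" using assms regions_edges by simp
  then show "3 \<le> card C" "finite C" by (auto simp: regions_def)
  obtain x y where xy: "x \<in> C" "y \<in> C" "(x, y) \<in> edges a f" "C \<subseteq> {x..y}"
    using region_extremes[OF C] .
  note b = edges_bounds[OF xy(3)]
  show "C \<subseteq> {a..a + extent f}" using b xy(4) by fastforce
  assume w: "width f \<noteq> 1"
  show "\<not> (a \<in> C \<and> a + extent f \<in> C)"
  proof
    assume "a \<in> C \<and> a + extent f \<in> C"
    then have "x = a" "y = a + extent f" using xy(4) b by fastforce+
    then show False using base_not_edge[OF w, of a] xy(3) by simp
  qed
qed

section \<open>Counting faces and their incidences with vertices\<close>

lemma finite_faces: "finite (faces a f)"
  by (induction f arbitrary: a) auto

text \<open>Faces on different sides of the vertex \<open>a + max 1 (extent k)\<close> share at most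
  that vertex. The cell on the base contains both ends of the base, which no face of
  \<open>k\<close> does.\<close>

lemma card_faces_Graft:
  assumes "branching (\<lambda>d. d \<noteq> 1) (Graft k r)"
  shows "card {C \<in> faces a (Graft k r). P C} =
    of_bool (k \<noteq> Empty \<and> P (corners a k)) + card {C \<in> faces a k. P C} +
    card {C \<in> faces (a + max 1 (extent k)) r. P C}"
proof -
  define b where "b = a + max 1 (extent k)"
  define X where "X = {C. C = corners a k \<and> k \<noteq> Empty \<and> P C}"
  have finX: "finite X" by (rule finite_subset[of _ "{corners a k}"]) (auto simp: X_def)
  have cardX: "card X = of_bool (k \<noteq> Empty \<and> P (corners a k))"
  proof (cases "k \<noteq> Empty \<and> P (corners a k)")
    case True
    then have "X = {corners a k}" by (auto simp: X_def)
    then show ?thesis using True by simp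
  next
    case False
    then have "X = {}" by (auto simp: X_def)
    then show ?thesis using False by simp
  qed
  have ck: "corners a k \<notin> faces a k"
    using face_bounds(4)[of k "corners a k" a] assms by (cases "k = Empty") auto
  have left: "C \<subseteq> {a..b}" if "C \<in> X \<or> C \<in> faces a k" for C
    using that face_bounds(1)[of k C a] corners_bounds[of _ a k] assms
    by (auto simp: X_def b_def; fastforce)
  have disj: "C \<notin> faces b r" if "C \<in> X \<or> C \<in> faces a k" for C
  proof
    assume C: "C \<in> faces b r"
    then have "C \<subseteq> {b}" using left[OF that] face_bounds(1)[of r C b] assms by fastforce
    from card_mono[OF _ this] show False using face_bounds(2)[of r C b] C assms by simp
  qed
  have "{C \<in> faces a (Graft k r). P C} = X \<union> {C \<in> faces a k. P C} \<union> {C \<in> faces b r. P C}"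
    by (auto simp: X_def b_def split: if_splits)
  also have "card \<dots> = card (X \<union> {C \<in> faces a k. P C}) + card {C \<in> faces b r. P C}"
    using disj finX by (intro card_Un_disjoint) (auto simp: finite_faces)
  also have "card (X \<union> {C \<in> faces a k. P C}) = card X + card {C \<in> faces a k. P C}"
    using ck finX by (intro card_Un_disjoint) (auto simp: finite_faces X_def)
  finally show ?thesis using cardX by (simp add: b_def)
qed

lemma card_faces: "branching (\<lambda>d. d \<noteq> 1) f \<Longrightarrow> card (faces a f) = nodes f"
proof (induction f arbitrary: a)
  case (Graft k r)
  show ?case using card_faces_Graft[OF Graft.prems, of a "\<lambda>_. True"] Graft by (simp del: faces.simps)
qed auto

lemma faces_periodic:
  "(\<forall>C\<in>faces a f. card C mod 3 = 3 mod 3) \<longleftrightarrow> branching (\<lambda>d. d mod 3 = 2) f"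
proof (induction f arbitrary: a)
  case (Graft k r)
  have "Suc (width k) mod 3 = 0 \<longleftrightarrow> width k mod 3 = 2" by presburger
  then show ?case using Graft by (auto simp: card_corners)
qed auto

fun incidences :: "nat \<Rightarrow> forest \<Rightarrow> nat \<Rightarrow> nat" where
  "incidences a Empty i = of_bool (i = a)"
| "incidences a (Graft k r) i = of_bool (i = a) + (if k = Empty then 0 else incidences a k i) +
     incidences (a + max 1 (extent k)) r i"

text \<open>The summand for \<open>corners a f\<close> accounts for the cell on the base, which is
  absent from \<open>faces\<close>.\<close>

lemma incidences_eq:
  "branching (\<lambda>d. d \<noteq> 1) f \<Longrightarrow>
    card {C \<in> faces a f. i \<in> C} + of_bool (i \<in> corners a f) = incidences a f i"
proof (induction f arbitrary: a)
  case (Graft k r)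
  define b where "b = a + max 1 (extent k)"
  have "a \<notin> corners b r" using corners_bounds[of a b r] by (auto simp: b_def)
  then have c: "of_bool (i \<in> corners a (Graft k r)) = (of_bool (i = a) + of_bool (i \<in> corners b r) :: nat)"
    by (auto simp: b_def)
  have "card {C \<in> faces a (Graft k r). i \<in> C} = of_bool (k \<noteq> Empty \<and> i \<in> corners a k) +
      card {C \<in> faces a k. i \<in> C} + card {C \<in> faces b r. i \<in> C}"
    unfolding b_def by (rule card_faces_Graft[OF Graft.prems])
  moreover have "card {C \<in> faces b r. i \<in> C} + of_bool (i \<in> corners b r) = incidences b r i"
    by (rule Graft.IH(2)) (use Graft.prems in simp)
  moreover have "of_bool (k \<noteq> Empty \<and> i \<in> corners a k) + card {C \<in> faces a k. i \<in> C} =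
      (if k = Empty then 0 else incidences a k i)"
    using Graft.IH(1)[of a] Graft.prems by (cases "k = Empty") auto
  moreover have "incidences a (Graft k r) i =
      of_bool (i = a) + (if k = Empty then 0 else incidences a k i) + incidences b r i"
    by (simp add: b_def)
  ultimately show ?case using c by linarith
qed auto

lemma incidences_outside: "a + extent f < i \<Longrightarrow> incidences a f i = 0"
  by (induction f arbitrary: a) (auto simp: max_extent split: if_splits)

text \<open>The longest edge starting at \<open>a\<close> becomes the base of the first tree. No
  edge crosses it, so the others lie below it or to its right, and both parts are again of this
  kind.\<close>

lemma noncrossing_forest:
  assumes "finite E" "a \<le> b" "\<And>x y. (x, y) \<in> E \<Longrightarrow> a \<le> x \<and> x < y \<and> y \<le> b"
    and "\<And>i. a \<le> i \<Longrightarrow> i < b \<Longrightarrow> (i, Suc i) \<in> E"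
    and "\<And>e e'. e \<in> E \<Longrightarrow> e' \<in> E \<Longrightarrow> \<not> crossing e e'"
  shows "\<exists>f. branching (\<lambda>d. d \<noteq> 1) f \<and> extent f = b - a \<and> edges a f = E"
  using assms
proof (induction "card E" arbitrary: E a b rule: less_induct)
  case less
  note bnd = less.prems(3) and unit = less.prems(4) and nc = less.prems(5)
  show ?case
  proof (cases "a = b")
    case True
    have "e \<notin> E" for e using bnd[of "fst e" "snd e"] True by auto
    then show ?thesis using True by (intro exI[of _ Empty]) auto
  next
    case False
    then have ab: "a < b" using less.prems by simp
    define Y where "Y = {y. (a, y) \<in> E}"
    define y where "y = Max Y"
    have Y: "finite Y" "Y \<noteq> {}"
      using bnd unit[of a] ab by (auto simp: Y_def intro!: finite_subset[of _ "{..b}"])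
    then have "y \<in> Y" unfolding y_def by (rule Max_in)
    then have ay: "(a, y) \<in> E" by (simp add: Y_def)
    have ymax: "z \<le> y" if "(a, z) \<in> E" for z
      unfolding y_def by (rule Max_ge) (use Y that in \<open>auto simp: Y_def\<close>)
    have y: "a < y" "y \<le> b" using bnd[OF ay] by auto
    define E1 where "E1 = {e \<in> E. snd e \<le> y} - {(a, y)}"
    define E2 where "E2 = {e \<in> E. y \<le> fst e}"
    have E: "E = insert (a, y) (E1 \<union> E2)"
    proof (intro equalityI subsetI)
      fix e assume e: "e \<in> E"
      obtain u v where uv: "e = (u, v)" by (cases e)
      have "a \<le> u" "u < v" using bnd e uv by auto
      have "v \<le> y \<or> y \<le> u"
      proof (rule ccontr)
        assume "\<not> (v \<le> y \<or> y \<le> u)"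
        moreover from this have "u \<noteq> a" using ymax[of v] e uv by auto
        ultimately have "crossing (a, y) (u, v)" using \<open>a \<le> u\<close> by (auto simp: crossing_def)
        then show False using nc[OF ay e] uv by simp
      qed
      then show "e \<in> insert (a, y) (E1 \<union> E2)" using e uv by (auto simp: E1_def E2_def)
    qed (use ay in \<open>auto simp: E1_def E2_def\<close>)
    have "(a, y) \<notin> E1" "(a, y) \<notin> E2" using y by (auto simp: E1_def E2_def)
    then have sub: "E1 \<subset> E" "E2 \<subset> E"
      using ay E by blast+
    have card: "card E1 < card E" "card E2 < card E"
      using sub less.prems(1) by (auto intro: psubset_card_mono)
    have fin: "finite E1" "finite E2" using sub less.prems(1) finite_subset by blast+
    have "\<exists>f. branching (\<lambda>d. d \<noteq> 1) f \<and> extent f = b - y \<and> edges y f = E2"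
    proof (rule less.hyps[OF card(2) fin(2) y(2)])
      show "y \<le> u \<and> u < v \<and> v \<le> b" if "(u, v) \<in> E2" for u v using that bnd by (auto simp: E2_def)
      show "(i, Suc i) \<in> E2" if "y \<le> i" "i < b" for i using that unit[of i] y by (auto simp: E2_def)
      show "\<not> crossing e e'" if "e \<in> E2" "e' \<in> E2" for e e' using that nc by (auto simp: E2_def)
    qed
    then obtain r where r: "branching (\<lambda>d. d \<noteq> 1) r" "extent r = b - y" "edges y r = E2" by blast
    have "\<exists>k. branching (\<lambda>d. d \<noteq> 1) k \<and> (k = Empty \<or> width k \<noteq> 1) \<and>
        max 1 (extent k) = y - a \<and> edges a k = E1"
    proof (cases "y = Suc a")
      case True
      have "e \<notin> E1" for e using bnd[of "fst e" "snd e"] True by (cases e) (auto simp: E1_def)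
      then show ?thesis using True by (intro exI[of _ Empty]) auto
    next
      case False
      have "\<exists>f. branching (\<lambda>d. d \<noteq> 1) f \<and> extent f = y - a \<and> edges a f = E1"
      proof (rule less.hyps[OF card(1) fin(1)])
        show "a \<le> y" using y by simp
        show "a \<le> u \<and> u < v \<and> v \<le> y" if "(u, v) \<in> E1" for u v using that bnd by (auto simp: E1_def)
        show "(i, Suc i) \<in> E1" if "a \<le> i" "i < y" for i
          using that unit[of i] y False by (auto simp: E1_def)
        show "\<not> crossing e e'" if "e \<in> E1" "e' \<in> E1" for e e' using that nc by (auto simp: E1_def)
      qed
      then obtain k where k: "branching (\<lambda>d. d \<noteq> 1) k" "extent k = y - a" "edges a k = E1" by blast
      \<comment> \<open>A single tree would have \<open>(a, y)\<close> as its own edge, but that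
        edge was removed from \<open>E1\<close>.\<close>
      have "width k \<noteq> 1"
      proof
        assume "width k = 1"
        then obtain k' where "k = Graft k' Empty" by (cases k) auto
        then have "(a, a + extent k) \<in> edges a k" by simp
        then show False using k y by (auto simp: E1_def)
      qed
      then show ?thesis using k y by (intro exI[of _ k]) auto
    qed
    then obtain k where k: "branching (\<lambda>d. d \<noteq> 1) k" "k = Empty \<or> width k \<noteq> 1"
      "max 1 (extent k) = y - a" "edges a k = E1" by blast
    have "extent (Graft k r) = b - a" using k(3) r(2) y by simp
    moreover have "edges a (Graft k r) = E" using k(3,4) r(3) y by (subst E) simp
    ultimately show ?thesis using k r by (intro exI[of _ "Graft k r"]) auto
  qed
qed

text \<open>The side \<open>(0, N - 1)\<close> serves as base: grafting \<open>f\<close> under one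
  root adds this edge and turns the root cell into a face.\<close>

lemma cells_eq_faces:
  assumes "N \<ge> 3" and f: "branching (\<lambda>d. d \<noteq> 1) (Graft f Empty)" "extent f = N - 1"
    and D: "D \<union> {(a, b). side N a b} = edges 0 (Graft f Empty)"
  shows "cells N D = faces 0 (Graft f Empty)"
proof -
  define E where "E = edges 0 (Graft f Empty)"
  have ext: "extent (Graft f Empty) = N - 1" using assms by simp
  have E: "side N a b \<or> (a, b) \<in> D \<longleftrightarrow> (a, b) \<in> E" for a b using D unfolding E_def by blast
  have adj: "consecutive_in N C a b \<longleftrightarrow> adjacent C a b" if "C \<subseteq> {0..<N}" for C a b
    using that unfolding consecutive_in_def adjacent_def by fastforce
  have "cells N D = regions E"
  proof (intro equalityI subsetI)
    fix C assume "C \<in> cells N D"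
    then show "C \<in> regions E"
      using adj[of C] finite_subset[of C "{0..<N}"] by (auto simp: cells_def regions_def E)
  next
    fix C assume C: "C \<in> regions E"
    obtain x y where xy: "(x, y) \<in> E" "C \<subseteq> {x..y}" using region_extremes[OF C] .
    then have "C \<subseteq> {0..<N}" using edges_bounds[of x y 0 "Graft f Empty"] ext assms(1)
      by (fastforce simp: E_def)
    then show "C \<in> cells N D" using C adj[of C] by (auto simp: cells_def regions_def E)
  qed
  then show ?thesis unfolding E_def regions_edges[OF f(1)] .
qed

lemma dissection_forest:
  assumes "dissection N D"
  shows "\<exists>f. branching (\<lambda>d. d \<noteq> 1) (Graft f Empty) \<and> extent f = N - 1 \<and>
    cells N D = faces 0 (Graft f Empty)"
proof -
  have N: "N \<ge> 3" and D: "\<And>a b. (a, b) \<in> D \<Longrightarrow> a < b \<and> b < N \<and> \<not> side N a b"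
    and nc: "\<And>e e'. e \<in> D \<Longrightarrow> e' \<in> D \<Longrightarrow> \<not> crossing e e'"
    using assms by (auto simp: dissection_def diagonals_def)
  \<comment> \<open>All sides except the base \<open>(0, N - 1)\<close> are added, which later
    excludes \<open>width f = 1\<close>.\<close>
  define E where "E = D \<union> {(i, Suc i) |i. Suc i < N}"
  have bnd: "0 \<le> x \<and> x < y \<and> y \<le> N - 1" if "(x, y) \<in> E" for x y
    using that D[of x y] by (auto simp: E_def)
  have unit_nc: "\<not> crossing (i, Suc i) e \<and> \<not> crossing e (i, Suc i)" for i e
    by (auto simp: crossing_def)
  have "\<exists>f. branching (\<lambda>d. d \<noteq> 1) f \<and> extent f = N - 1 - 0 \<and> edges 0 f = E"
  proof (rule noncrossing_forest)
    show "finite E" by (rule finite_subset[of _ "{0..N} \<times> {0..N}"]) (use bnd in fastforce)+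
    show "\<not> crossing e e'" if "e \<in> E" "e' \<in> E" for e e'
      using that nc unit_nc unfolding E_def by blast
    show "0 \<le> x \<and> x < y \<and> y \<le> N - 1" if "(x, y) \<in> E" for x y using bnd[OF that] .
    show "(i, Suc i) \<in> E" if "i < N - 1" for i using that by (auto simp: E_def)
  qed simp
  then obtain f where f: "branching (\<lambda>d. d \<noteq> 1) f" "extent f = N - 1" "edges 0 f = E" by auto
  have "(0, N - 1) \<notin> E" using D[of 0 "N - 1"] N by (auto simp: E_def side_def)
  have "width f \<noteq> 1"
  proof
    assume "width f = 1"
    then obtain k' where "f = Graft k' Empty" by (cases f) auto
    then have "(0, 0 + extent f) \<in> edges 0 f" by simp
    then show False using f \<open>(0, N - 1) \<notin> E\<close> by simp
  qed
  then have b: "branching (\<lambda>d. d \<noteq> 1) (Graft f Empty)" using f by simp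
  have "D \<union> {(a, b). side N a b} = insert (0, N - 1) E"
    using N by (auto simp: E_def side_def)
  also have "\<dots> = edges 0 (Graft f Empty)" using f N by simp
  finally show ?thesis using cells_eq_faces[OF N b f(2)] b f(2) by blast
qed

lemma forest_dissection:
  assumes "N \<ge> 3" "branching (\<lambda>d. d \<noteq> 1) (Graft f Empty)" "extent f = N - 1"
  shows "\<exists>D. dissection N D \<and> cells N D = faces 0 (Graft f Empty)"
proof -
  define D where "D = edges 0 f - {(a, b). side N a b}"
  have bnd: "a < b \<and> b < N" if "(a, b) \<in> edges 0 f" for a b
    using edges_bounds[OF that] assms by auto
  have "dissection N D"
    using assms(1) bnd edges_noncrossing[of _ 0 f]
    by (auto simp: dissection_def D_def diagonals_def)
  moreover have "D \<union> {(a, b). side N a b} = edges 0 (Graft f Empty)"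
    using assms(1,3) unit_edges[of 0 _ f] by (auto simp: D_def side_def)
  ultimately show ?thesis using cells_eq_faces[OF assms] by blast
qed

section \<open>Quiddities as words\<close>

lemma periodic_branching:
  "branching (\<lambda>d. d mod 3 = 2) f \<Longrightarrow> branching (\<lambda>d. d \<noteq> 1) f"
  by (induction f) auto

lemma count_dword:
  "count_list (dword f) S = 2 * nodes f" "count_list (dword f) U = extent f + 2 * nodes f"
  by (induction f) (auto simp: max_extent)

text \<open>These are the words that begin and end with \<open>U\<close> and have no two consecutive
  letters \<open>S\<close>.\<close>

fun proper :: "letter list \<Rightarrow> bool" where
  "proper [U] = True"
| "proper (U # U # w) = proper (U # w)"
| "proper (U # S # w) = proper w"
| "proper _ = False"

lemma proper_start: "proper w \<Longrightarrow> \<exists>v. w = U # v"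
  by (cases w rule: proper.cases) auto

lemma proper_dword: "proper v \<Longrightarrow> proper (dword f @ v)"
proof (induction f arbitrary: v)
  case (Graft k r)
  have r: "proper (dword r @ v)" using Graft by blast
  show ?case
  proof (cases "k = Empty")
    case True
    then show ?thesis using r proper_start[OF r] by auto
  next
    case False
    then show ?thesis using Graft.IH(1)[of "U # S # dword r @ v"] r by simp
  qed
qed auto

text \<open>The number of letters \<open>U\<close> read at vertex \<open>i\<close> when reading starts at vertex \<open>a\<close>.\<close>
fun occurrences :: "nat \<Rightarrow> letter list \<Rightarrow> nat \<Rightarrow> nat" where
  "occurrences a [] i = 0"
| "occurrences a (S # w) i = occurrences a w i"
| "occurrences a [U] i = of_bool (i = a)"
| "occurrences a (U # U # w) i = of_bool (i = a) + occurrences (Suc a) (U # w) i"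
| "occurrences a (U # S # w) i = of_bool (i = a) + occurrences a w i"

lemma occurrences_before: "i < a \<Longrightarrow> occurrences a w i = 0"
  by (induction a w i rule: occurrences.induct) auto

lemma occurrences_start: "occurrences a (U # w) a \<ge> 1"
  by (cases w; cases "hd w") auto

text \<open>The word is decoded letter by letter: after a \<open>U\<close> read at \<open>a\<close>,
  a further \<open>U\<close> still due at \<open>a\<close> forces \<open>S\<close>; otherwise one
  due at a later vertex forces \<open>UU\<close>, and if none is due the word ends.\<close>

lemma occurrences_inject:
  "proper w \<Longrightarrow> proper w' \<Longrightarrow> occurrences a w = occurrences a w' \<Longrightarrow> w = w'"
proof (induction w arbitrary: a w' rule: proper.induct)
  case 1
  show ?case using "1.prems"(2)
  proof (cases w' rule: proper.cases)
    case (2 v)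
    then show ?thesis
      using fun_cong[OF "1.prems"(3), of "Suc a"] occurrences_start[of "Suc a" v] by simp
  next
    case (3 v)
    then obtain u where "v = U # u" using "1.prems"(2) proper_start by auto
    then show ?thesis
      using 3 fun_cong[OF "1.prems"(3), of a] occurrences_start[of a u] by simp
  qed auto
next
  case (2 w)
  show ?case using "2.prems"(2)
  proof (cases w' rule: proper.cases)
    case 1
    then show ?thesis
      using fun_cong[OF "2.prems"(3), of "Suc a"] occurrences_start[of "Suc a" w] by simp
  next
    case (2 v)
    have "occurrences (Suc a) (U # w) = occurrences (Suc a) (U # v)"
      using fun_cong[OF "2.prems"(3)] 2 by (auto simp: fun_eq_iff)
    then have "U # w = U # v" using "2.IH" "2.prems" 2 by auto
    then show ?thesis using 2 by simp
  next
    case (3 v)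
    then obtain u where "v = U # u" using "2.prems"(2) proper_start by auto
    then show ?thesis
      using 3 fun_cong[OF "2.prems"(3), of a] occurrences_start[of a u]
      by (simp add: occurrences_before)
  qed auto
next
  case (3 w)
  obtain u where u: "w = U # u" using "3.prems"(1) proper_start by auto
  show ?case using "3.prems"(2)
  proof (cases w' rule: proper.cases)
    case 1
    then show ?thesis
      using u fun_cong[OF "3.prems"(3), of a] occurrences_start[of a u] by simp
  next
    case (2 v)
    then show ?thesis
      using u fun_cong[OF "3.prems"(3), of a] occurrences_start[of a u]
      by (simp add: occurrences_before)
  next
    case (3 v)
    have "occurrences a w = occurrences a v"
      using fun_cong[OF "3.prems"(3)] 3 by (auto simp: fun_eq_iff)
    then have "w = v" using "3.IH" "3.prems" 3 by auto
    then show ?thesis using 3 by simp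
  qed auto
qed auto

text \<open>The appended \<open>U\<close> is the last incidence of the cell on the base. The
  condition on \<open>z\<close> rules out a passage \<open>UU\<close> right after it, so
  \<open>z\<close> is read from the same vertex.\<close>

lemma occurrences_dword:
  "z = [] \<or> hd z = S \<Longrightarrow>
    occurrences a (dword f @ U # z) i = incidences a f i + occurrences (a + extent f) z i"
proof (induction f arbitrary: a z)
  case Empty
  then show ?case by (cases z) auto
next
  case (Graft k r)
  show ?case
  proof (cases "k = Empty")
    case True
    obtain v where "dword r @ U # z = U # v" by (cases r) auto
    moreover from this have "occurrences (Suc a) (U # v) i =
        incidences (Suc a) r i + occurrences (Suc a + extent r) z i"
      using Graft.IH(2)[OF Graft.prems, of "Suc a"] by simp
    ultimately show ?thesis using True by simp
  next
    case False
    have "occurrences a (dword (Graft k r) @ U # z) i =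
        of_bool (i = a) + occurrences a (dword k @ U # S # dword r @ U # z) i"
      using False by simp
    also have "\<dots> = of_bool (i = a) + incidences a k i +
        occurrences (a + extent k) (dword r @ U # z) i"
      using Graft.IH(1)[of "S # dword r @ U # z" a] by simp
    also have "\<dots> = of_bool (i = a) + incidences a k i + incidences (a + extent k) r i +
        occurrences (a + extent k + extent r) z i"
      using Graft.IH(2)[OF Graft.prems] by simp
    finally show ?thesis using False by (simp add: max_extent add.assoc)
  qed
qed

definition periodic_roots :: "nat \<Rightarrow> nat \<Rightarrow> forest set" where
  "periodic_roots n m = {f. branching (\<lambda>d. d mod 3 = 2) f \<and> width f mod 3 = 2 \<and>
     extent f = Suc n \<and> Suc (nodes f) = m}"

lemma quiddities_eq:
  assumes "n \<ge> 1"
  shows "{quiddity (n + 2) D |D. dissection (n + 2) D \<and> periodic 3 (n + 2) D \<and>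
      card (cells (n + 2) D) = m} =
    (\<lambda>f. map (incidences 0 f) [0..<n + 2]) ` periodic_roots n m" (is "?L = ?R")
proof -
  have quid: "quiddity (n + 2) D = map (incidences 0 f) [0..<n + 2]"
    and per: "periodic 3 (n + 2) D \<longleftrightarrow> branching (\<lambda>d. d mod 3 = 2) (Graft f Empty)"
    and num: "card (cells (n + 2) D) = Suc (nodes f)"
    if f: "branching (\<lambda>d. d \<noteq> 1) (Graft f Empty)" "extent f = Suc n"
      "cells (n + 2) D = faces 0 (Graft f Empty)" for f D
  proof -
    have ne: "f \<noteq> Empty" using f(2) by auto
    have "card {C \<in> faces 0 (Graft f Empty). i \<in> C} = incidences 0 f i" for i
      using card_faces_Graft[OF f(1), of 0 "\<lambda>C. i \<in> C"] incidences_eq[of f 0 i] f(1) ne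
      by (simp del: faces.simps(2))
    then show "quiddity (n + 2) D = map (incidences 0 f) [0..<n + 2]"
      unfolding quiddity_def f(3) by (simp only:)
    show "periodic 3 (n + 2) D \<longleftrightarrow> branching (\<lambda>d. d mod 3 = 2) (Graft f Empty)"
      unfolding periodic_def f(3) by (rule faces_periodic)
    show "card (cells (n + 2) D) = Suc (nodes f)"
      unfolding f(3) using card_faces[OF f(1), of 0] ne by simp
  qed
  show ?thesis
  proof (intro equalityI subsetI)
    fix q assume "q \<in> ?L"
    then obtain D where D: "q = quiddity (n + 2) D" "dissection (n + 2) D" "periodic 3 (n + 2) D"
      "card (cells (n + 2) D) = m" by blast
    obtain f where f: "branching (\<lambda>d. d \<noteq> 1) (Graft f Empty)" "extent f = Suc n"
      "cells (n + 2) D = faces 0 (Graft f Empty)" using dissection_forest[OF D(2)] by auto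
    have "f \<noteq> Empty" using f(2) by auto
    then have "f \<in> periodic_roots n m"
      using per[OF f] num[OF f] D f(2) by (auto simp: periodic_roots_def)
    then show "q \<in> ?R" using quid[OF f] D(1) by blast
  next
    fix q assume "q \<in> ?R"
    then obtain f where f: "f \<in> periodic_roots n m" "q = map (incidences 0 f) [0..<n + 2]" by blast
    then have p: "branching (\<lambda>d. d mod 3 = 2) (Graft f Empty)" and e: "extent f = Suc n"
      and m: "Suc (nodes f) = m"
      by (auto simp: periodic_roots_def)
    note b = periodic_branching[OF p]
    obtain D where D: "dissection (n + 2) D" "cells (n + 2) D = faces 0 (Graft f Empty)"
      using forest_dissection[OF _ b, of "n + 2"] e assms by auto
    have "q = quiddity (n + 2) D" "periodic 3 (n + 2) D" "card (cells (n + 2) D) = m"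
      using quid[OF b e D(2)] per[OF b e D(2)] num[OF b e D(2)] f(2) p m by (simp_all only:)
    then show "q \<in> ?L" using D(1) by blast
  qed
qed

text \<open>The quiddity is a function of the word, and an injective one: beyond the
  \<open>n + 2\<close> listed vertices all incidences vanish, so the list determines the
  word.\<close>

lemma Q_eq_card_words:
  assumes "n \<ge> 1"
  shows "Q n m = card (dword ` periodic_roots n m)"
proof -
  define \<phi> where "\<phi> w = map (occurrences 0 (w @ [U])) [0..<n + 2]" for w
  have occ: "occurrences 0 (dword f @ [U]) = incidences 0 f" for f
    using occurrences_dword[of "[]" 0 f] by auto
  have "inj_on \<phi> (dword ` periodic_roots n m)"
  proof (intro inj_onI, elim imageE)
    fix w w' f f'
    assume eq: "\<phi> w = \<phi> w'" and w: "w = dword f" "w' = dword f'"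
      and f: "f \<in> periodic_roots n m" "f' \<in> periodic_roots n m"
    have "incidences 0 f i = incidences 0 f' i" for i
    proof (cases "i < n + 2")
      case True
      then have "\<phi> w ! i = incidences 0 f i" "\<phi> w' ! i = incidences 0 f' i"
        by (simp_all add: \<phi>_def w occ del: upt_Suc)
      then show ?thesis using eq by simp
    next
      case False
      then show ?thesis using f incidences_outside[of 0 f i] incidences_outside[of 0 f' i]
        by (simp add: periodic_roots_def)
    qed
    then have "occurrences 0 (w @ [U]) = occurrences 0 (w' @ [U])" by (auto simp: w occ)
    then have "w @ [U] = w' @ [U]"
      using occurrences_inject[of "w @ [U]" "w' @ [U]" 0] by (simp add: w proper_dword)
    then show "w = w'" by simp
  qed
  moreover have "(\<lambda>f. map (incidences 0 f) [0..<n + 2]) ` periodic_roots n m =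
      \<phi> ` dword ` periodic_roots n m"
    unfolding image_image \<phi>_def occ ..
  ultimately show ?thesis
    unfolding Q_def quiddities_eq[OF assms] by (simp only: card_image)
qed

text \<open>The parameters are visible in the word, the letters \<open>S\<close> giving the number
  of nodes and then the letters \<open>U\<close> the extent. Hence both changes of forest preserve
  \<open>n\<close> and \<open>m\<close>.\<close>

lemma periodic_words_eq_canonical_words:
  "dword ` periodic_roots n m = cword ` canonical_roots n m"
proof (intro equalityI subsetI)
  fix w assume "w \<in> dword ` periodic_roots n m"
  then obtain f where f: "w = dword f" "f \<in> periodic_roots n m" by blast
  then obtain g where g: "branching even g" "width g mod 3 = width f mod 3" "cword g = dword f"
    using canonical_of_periodic[of f] by (auto simp: periodic_roots_def)
  have "nodes g = nodes f" using count_cword(2)[OF g(1)] count_dword(1)[of f] g(3) by simp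
  then have "g \<in> canonical_roots n m"
    using f(2) g count_dword(2)[of f] by (auto simp: canonical_roots_def periodic_roots_def)
  then show "w \<in> cword ` canonical_roots n m" using g(3) f(1) by (metis imageI)
next
  fix w assume "w \<in> cword ` canonical_roots n m"
  then obtain g where g: "w = cword g" "g \<in> canonical_roots n m" by blast
  then have be: "branching even g" by (simp add: canonical_roots_def)
  then obtain f where f: "branching (\<lambda>d. d mod 3 = 2) f" "width f = width g" "dword f = cword g"
    using periodic_of_canonical by blast
  have "nodes g = nodes f" using count_cword(2)[OF be] count_dword(1)[of f] f(3) by simp
  then have "f \<in> periodic_roots n m"
    using g(2) f count_dword(2)[of f] by (auto simp: canonical_roots_def periodic_roots_def)
  then show "w \<in> dword ` periodic_roots n m" using f(3) g(1) by (metis imageI)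
qed

lemma Q_eq_card_canonical_roots:
  assumes "n \<ge> 1" "m \<ge> 1"
  shows "Q n m = card (canonical_roots n m)"
proof -
  have "inj_on cword (canonical_roots n m)"
    by (auto simp: inj_on_def canonical_roots_def intro: cword_inject)
  then show ?thesis
    unfolding Q_eq_card_words[OF assms(1)] periodic_words_eq_canonical_words by (rule card_image)
qed

theorem mainTheorem1:
  fixes n m :: nat
  assumes "n \<ge> 1" and "m \<ge> 1"
  shows "(n mod 3 \<noteq> m mod 3 \<longrightarrow> Q n m = 0) \<and>
         (n mod 3 = m mod 3 \<longrightarrow>
            real (Q n m) =
              (\<Sum>s | 3 * s + m \<le> n.
                 (real n - real m - 3 * real s + 2) / (real n - real s + 1)
                 * real ((m + s - 2) choose s) * real ((n + m - s - 1) choose (m - 1))))"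
  unfolding Q_eq_card_canonical_roots[OF assms]
  using card_canonical_roots_formula[OF assms] canonical_roots_eq[OF assms(2)] by simp

end
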